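(* Let $A$ be a Johnson pseudo-contractible Banach algebra with an identity element. Then $A$ is amenable.
   Context: For a Banach algebra $A$, let $A\otimes_p A$ be the (completed) projective tensor product, a Banach $A$-bimodule with actions determined by $a\cdot(b\otimes c)=ab\otimes c$ and $(b\otimes c)\cdot a=b\otimes ca$, and let $\pi_A:A\otimes_p A\to A$ be the bounded linear map determined by $\pi_A(a\otimes b)=ab$ (an $A$-bimodule morphism). The biduals $A^{**}$ and $(A\otimes_p A)^{**}$ carry the induced bidual $A$-bimodule structures, and $A$ is regarded as canonically embedded in $A^{**}$. $A$ is called amenable if it has a virtual diagonal, i.e. there is $M\in(A\otimes_p A)^{**}$ with $a\cdot M=M\cdot a$ and $\pi_A^{**}(M)a=a$ for every $a\in A$. $A$ is called Johnson pseudo-contractible if there is a (not necessarily bounded) net $(m_\alpha)$ in $(A\otimes_p A)^{**}$ such that $a\cdot m_\alpha=m_\alpha\cdot a$ for all $\alpha$ and $\pi_A^{**}(m_\alpha)a-a\to 0$ in norm, for every $a\in A$. *)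

theory Defs
  imports "HOL-Analysis.Analysis" "HOL-Library.Poly_Mapping"
begin

section \<open>Complex normed spaces and algebras\<close>

text \<open>The real scalar multiplication of the library classes is required to be the restriction
  of the complex one, so that the library theory of real normed spaces applies.\<close>

class complex_vector = real_vector +
  fixes scaleC :: "complex \<Rightarrow> 'a \<Rightarrow> 'a" (infixr \<open>*\<^sub>C\<close> 75)
  assumes scaleC_add_right: "c *\<^sub>C (x + y) = c *\<^sub>C x + c *\<^sub>C y"
    and scaleC_add_left: "(c + d) *\<^sub>C x = c *\<^sub>C x + d *\<^sub>C x"
    and scaleC_scaleC: "c *\<^sub>C (d *\<^sub>C x) = (c * d) *\<^sub>C x"
    and scaleC_one: "1 *\<^sub>C x = x"
    and scaleR_scaleC: "r *\<^sub>R x = complex_of_real r *\<^sub>C x"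

class complex_normed_vector = complex_vector + real_normed_vector +
  assumes norm_scaleC: "norm (c *\<^sub>C x) = cmod c * norm x"

text \<open>Complex Banach algebras are the types of sort
  \<open>{complex_normed_algebra, banach}\<close>; no identity element is assumed.\<close>

class complex_normed_algebra = complex_normed_vector + real_normed_algebra +
  assumes mult_scaleC_left: "(c *\<^sub>C x) * y = c *\<^sub>C (x * y)"
    and mult_scaleC_right: "x * (c *\<^sub>C y) = c *\<^sub>C (x * y)"

instantiation complex :: complex_normed_algebra
begin

definition scaleC_complex :: "complex \<Rightarrow> complex \<Rightarrow> complex"
  where "scaleC_complex c x = c * x"

instance
  by standard (auto simp: scaleC_complex_def algebra_simps norm_mult scaleR_conv_of_real)

end

lemma scaleC_zero_right [simp]: "c *\<^sub>C (0::'a::complex_vector) = 0"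
  using scaleC_add_right[of c 0 "0::'a"] by simp

lemma scaleC_zero_left [simp]: "0 *\<^sub>C (x::'a::complex_vector) = 0"
  using scaleC_add_left[of 0 0 x] by simp

lemma scaleC_minus_right: "c *\<^sub>C (- x) = - (c *\<^sub>C (x::'a::complex_vector))"
  using scaleC_add_right[of c x "- x"] by (simp add: eq_neg_iff_add_eq_0 add.commute)

lemma scaleC_diff_right: "c *\<^sub>C (x - y) = c *\<^sub>C x - c *\<^sub>C (y::'a::complex_vector)"
  using scaleC_add_right[of c x "- y"] by (simp add: scaleC_minus_right)

lemma scaleC_minus_one: "(-1) *\<^sub>C x = - (x::'a::complex_vector)"
  using scaleC_add_left[of 1 "-1" x] by (simp add: scaleC_one eq_neg_iff_add_eq_0 add.commute)

lemma scaleC_sum_right: "c *\<^sub>C (\<Sum>i\<in>I. f i) = (\<Sum>i\<in>I. c *\<^sub>C (f i :: 'a::complex_vector))"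
  by (induction I rule: infinite_finite_induct) (auto simp: scaleC_add_right)

lemma bounded_linear_scaleC: "bounded_linear (\<lambda>x::'a::complex_normed_vector. c *\<^sub>C x)"
  by (rule bounded_linear_intro[where K="cmod c"])
     (auto simp: scaleC_add_right norm_scaleC scaleR_scaleC scaleC_scaleC mult.commute)


section \<open>Bounded complex-linear maps, duals and adjoints\<close>

text \<open>The norm is the operator norm of the library type of bounded real-linear maps.\<close>

typedef (overloaded) ('a, 'b) cblinfun (\<open>(_ \<Rightarrow>\<^sub>C\<^sub>L /_)\<close> [22, 21] 21) =
  "{f :: 'a::complex_normed_vector \<Rightarrow>\<^sub>L 'b::complex_normed_vector.
     \<forall>c x. blinfun_apply f (c *\<^sub>C x) = c *\<^sub>C blinfun_apply f x}"
  morphisms blinfun_of_cblinfun Abs_cblinfun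
  by (rule exI[of _ 0]) simp

setup_lifting type_definition_cblinfun

lift_definition cblinfun_apply :: "'a::complex_normed_vector \<Rightarrow>\<^sub>C\<^sub>L 'b::complex_normed_vector \<Rightarrow> 'a \<Rightarrow> 'b"
  is blinfun_apply .

definition CBlinfun :: "('a::complex_normed_vector \<Rightarrow> 'b::complex_normed_vector) \<Rightarrow> 'a \<Rightarrow>\<^sub>C\<^sub>L 'b"
  where "CBlinfun f = Abs_cblinfun (Blinfun f)"

lemma cblinfun_apply_CBlinfun:
  assumes "bounded_linear f" "\<And>c x. f (c *\<^sub>C x) = c *\<^sub>C f x"
  shows "cblinfun_apply (CBlinfun f) = f"
  unfolding CBlinfun_def cblinfun_apply.rep_eq
  using assms by (subst Abs_cblinfun_inverse) (auto simp: bounded_linear_Blinfun_apply)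

lemma cblinfun_eqI: "(\<And>x. cblinfun_apply f x = cblinfun_apply g x) \<Longrightarrow> f = g"
  by transfer (rule blinfun_eqI)

lemma bounded_linear_cblinfun_apply: "bounded_linear (cblinfun_apply f)"
  by transfer (rule blinfun.bounded_linear_right)

lemma cblinfun_apply_scaleC: "cblinfun_apply f (c *\<^sub>C x) = c *\<^sub>C cblinfun_apply f x"
  by transfer auto

instantiation cblinfun :: (complex_normed_vector, complex_normed_vector) complex_normed_vector
begin

lift_definition norm_cblinfun :: "'a \<Rightarrow>\<^sub>C\<^sub>L 'b \<Rightarrow> real" is norm .

lift_definition zero_cblinfun :: "'a \<Rightarrow>\<^sub>C\<^sub>L 'b" is 0
  by simp

lift_definition plus_cblinfun :: "'a \<Rightarrow>\<^sub>C\<^sub>L 'b \<Rightarrow> 'a \<Rightarrow>\<^sub>C\<^sub>L 'b \<Rightarrow> 'a \<Rightarrow>\<^sub>C\<^sub>L 'b" is "(+)"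
  by (simp add: blinfun.add_left scaleC_add_right)

lift_definition minus_cblinfun :: "'a \<Rightarrow>\<^sub>C\<^sub>L 'b \<Rightarrow> 'a \<Rightarrow>\<^sub>C\<^sub>L 'b \<Rightarrow> 'a \<Rightarrow>\<^sub>C\<^sub>L 'b" is "(-)"
  by (simp add: blinfun.diff_left scaleC_diff_right)

lift_definition uminus_cblinfun :: "'a \<Rightarrow>\<^sub>C\<^sub>L 'b \<Rightarrow> 'a \<Rightarrow>\<^sub>C\<^sub>L 'b" is "uminus"
  by (simp add: blinfun.minus_left scaleC_minus_right)

lift_definition scaleR_cblinfun :: "real \<Rightarrow> 'a \<Rightarrow>\<^sub>C\<^sub>L 'b \<Rightarrow> 'a \<Rightarrow>\<^sub>C\<^sub>L 'b" is scaleR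
  by (simp add: blinfun.scaleR_left scaleR_scaleC scaleC_scaleC mult.commute)

lift_definition scaleC_cblinfun :: "complex \<Rightarrow> 'a \<Rightarrow>\<^sub>C\<^sub>L 'b \<Rightarrow> 'a \<Rightarrow>\<^sub>C\<^sub>L 'b"
  is "\<lambda>c f. Blinfun (\<lambda>x. c *\<^sub>C blinfun_apply f x)"
  by (simp add: bounded_linear_Blinfun_apply scaleC_scaleC mult.commute
      bounded_linear_compose[OF bounded_linear_scaleC blinfun.bounded_linear_right])

definition dist_cblinfun :: "'a \<Rightarrow>\<^sub>C\<^sub>L 'b \<Rightarrow> 'a \<Rightarrow>\<^sub>C\<^sub>L 'b \<Rightarrow> real"
  where "dist_cblinfun f g = norm (f - g)"

definition sgn_cblinfun :: "'a \<Rightarrow>\<^sub>C\<^sub>L 'b \<Rightarrow> 'a \<Rightarrow>\<^sub>C\<^sub>L 'b"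
  where "sgn_cblinfun f = scaleR (inverse (norm f)) f"

definition uniformity_cblinfun :: "(('a \<Rightarrow>\<^sub>C\<^sub>L 'b) \<times> ('a \<Rightarrow>\<^sub>C\<^sub>L 'b)) filter"
  where "uniformity_cblinfun = (INF e\<in>{0 <..}. principal {(x, y). dist x y < e})"

definition open_cblinfun :: "('a \<Rightarrow>\<^sub>C\<^sub>L 'b) set \<Rightarrow> bool"
  where "open_cblinfun S = (\<forall>x\<in>S. \<forall>\<^sub>F (x', y) in uniformity. x' = x \<longrightarrow> y \<in> S)"

lemma apply_scaleC_aux:
  "blinfun_apply (Blinfun (\<lambda>x. c *\<^sub>C blinfun_apply f x)) x = c *\<^sub>C blinfun_apply f x"
  for f :: "'a \<Rightarrow>\<^sub>L 'b"
  by (simp add: bounded_linear_Blinfun_apply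
      bounded_linear_compose[OF bounded_linear_scaleC blinfun.bounded_linear_right])

lemma norm_scaleC_aux:
  "norm (Blinfun (\<lambda>x. c *\<^sub>C blinfun_apply f x)) = cmod c * norm f" for f :: "'a \<Rightarrow>\<^sub>L 'b"
proof -
  have le: "norm (Blinfun (\<lambda>x. c *\<^sub>C blinfun_apply f x)) \<le> cmod c * norm f" for c and f :: "'a \<Rightarrow>\<^sub>L 'b"
    by (rule norm_blinfun_bound)
       (auto simp: apply_scaleC_aux norm_scaleC mult.assoc intro!: mult_left_mono norm_blinfun)
  show ?thesis
  proof (cases "c = 0")
    case True
    then show ?thesis using le[of 0 f] by simp
  next
    case False
    let ?g = "Blinfun (\<lambda>x. c *\<^sub>C blinfun_apply f x)"
    have "f = Blinfun (\<lambda>x. inverse c *\<^sub>C blinfun_apply ?g x)"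
      by (rule blinfun_eqI, (subst apply_scaleC_aux)+) (simp add: scaleC_scaleC False scaleC_one)
    then have "norm f \<le> cmod (inverse c) * norm ?g"
      using le[of "inverse c" ?g] by simp
    then have "cmod c * norm f \<le> cmod c * (inverse (cmod c) * norm ?g)"
      by (intro mult_left_mono) (simp_all only: norm_inverse norm_ge_zero)
    also have "\<dots> = norm ?g"
      using False by (simp only: mult.assoc[symmetric] right_inverse norm_eq_zero) simp
    finally have "cmod c * norm f \<le> norm ?g" .
    with le[of c f] show ?thesis by simp
  qed
qed

instance
proof
  fix f g h :: "'a \<Rightarrow>\<^sub>C\<^sub>L 'b" and c d :: complex and r s :: real
  show "f + g + h = f + (g + h)" by transfer (rule add.assoc)
  show "f + g = g + f" by transfer (rule add.commute)
  show "0 + f = f" by transfer simp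
  show "- f + f = 0" by transfer simp
  show "f - g = f + - g" by transfer simp
  show "r *\<^sub>R (f + g) = r *\<^sub>R f + r *\<^sub>R g" by transfer (rule scaleR_add_right)
  show "(r + s) *\<^sub>R f = r *\<^sub>R f + s *\<^sub>R f" by transfer (rule scaleR_add_left)
  show "r *\<^sub>R s *\<^sub>R f = (r * s) *\<^sub>R f" by transfer simp
  show "1 *\<^sub>R f = f" by transfer simp
  show "c *\<^sub>C (f + g) = c *\<^sub>C f + c *\<^sub>C g"
    by transfer (rule blinfun_eqI, (subst apply_scaleC_aux | subst blinfun.add_left)+, simp add: scaleC_add_right)
  show "(c + d) *\<^sub>C f = c *\<^sub>C f + d *\<^sub>C f"
    by transfer (rule blinfun_eqI, (subst apply_scaleC_aux | subst blinfun.add_left)+, simp add: scaleC_add_left)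
  show "c *\<^sub>C d *\<^sub>C f = (c * d) *\<^sub>C f"
    by transfer (rule blinfun_eqI, (subst apply_scaleC_aux | subst blinfun.add_left)+, simp add: scaleC_scaleC)
  show "1 *\<^sub>C f = f"
    by transfer (rule blinfun_eqI, (subst apply_scaleC_aux | subst blinfun.add_left)+, simp add: scaleC_one)
  show "r *\<^sub>R f = complex_of_real r *\<^sub>C f"
    by transfer (rule blinfun_eqI, (subst apply_scaleC_aux | subst blinfun.add_left)+, simp add: blinfun.scaleR_left scaleR_scaleC)
  show "dist f g = norm (f - g)" by (rule dist_cblinfun_def)
  show "sgn f = inverse (norm f) *\<^sub>R f" by (rule sgn_cblinfun_def)
  show "(uniformity :: (('a \<Rightarrow>\<^sub>C\<^sub>L 'b) \<times> ('a \<Rightarrow>\<^sub>C\<^sub>L 'b)) filter) = (INF e\<in>{0 <..}. principal {(x, y). dist x y < e})"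
    by (rule uniformity_cblinfun_def)
  show "open U = (\<forall>x\<in>U. \<forall>\<^sub>F (x', y) in uniformity. x' = x \<longrightarrow> y \<in> U)" for U :: "('a \<Rightarrow>\<^sub>C\<^sub>L 'b) set"
    by (rule open_cblinfun_def)
  show "(norm f = 0) = (f = 0)" by transfer simp
  show "norm (f + g) \<le> norm f + norm g" by transfer (rule norm_triangle_ineq)
  show "norm (r *\<^sub>R f) = \<bar>r\<bar> * norm f" by transfer simp
  show "norm (c *\<^sub>C f) = cmod c * norm f" by transfer (rule norm_scaleC_aux)
qed

end

lemma cblinfun_apply_add_left: "cblinfun_apply (f + g) x = cblinfun_apply f x + cblinfun_apply g x"
  by transfer (rule blinfun.add_left)

lemma cblinfun_apply_scaleC_left: "cblinfun_apply (c *\<^sub>C f) x = c *\<^sub>C cblinfun_apply f x"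
  by transfer (rule apply_scaleC_aux)

lemma cblinfun_apply_scaleR_left: "cblinfun_apply (r *\<^sub>R f) x = r *\<^sub>R cblinfun_apply f x"
  by transfer (rule blinfun.scaleR_left)

lemma norm_cblinfun: "norm (cblinfun_apply f x) \<le> norm f * norm x"
  by transfer (rule norm_blinfun)

lemma norm_cblinfun_bound:
  "0 \<le> b \<Longrightarrow> (\<And>x. norm (cblinfun_apply f x) \<le> b * norm x) \<Longrightarrow> norm f \<le> b"
  by transfer (rule norm_blinfun_bound)

type_synonym 'a dual = "'a \<Rightarrow>\<^sub>C\<^sub>L complex"
type_synonym 'a bidual = "'a dual dual"

definition canonical_embedding :: "'a::complex_normed_vector \<Rightarrow> 'a bidual"
  where "canonical_embedding x = CBlinfun (\<lambda>f. cblinfun_apply f x)"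

definition adjoint_map ::
    "('a::complex_normed_vector \<Rightarrow>\<^sub>C\<^sub>L 'b::complex_normed_vector) \<Rightarrow> 'b dual \<Rightarrow>\<^sub>C\<^sub>L 'a dual"
  where "adjoint_map T = CBlinfun (\<lambda>f. CBlinfun (\<lambda>x. cblinfun_apply f (cblinfun_apply T x)))"

definition biadjoint ::
    "('a::complex_normed_vector \<Rightarrow>\<^sub>C\<^sub>L 'b::complex_normed_vector) \<Rightarrow> 'a bidual \<Rightarrow>\<^sub>C\<^sub>L 'b bidual"
  where "biadjoint T = adjoint_map (adjoint_map T)"

lemma canonical_embedding_apply:
  "cblinfun_apply (canonical_embedding x) f = cblinfun_apply f x"
proof -
  have "bounded_linear (\<lambda>f. cblinfun_apply f x)"
    by (rule bounded_linear_intro[where K="norm x"])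
       (auto simp: cblinfun_apply_add_left cblinfun_apply_scaleR_left norm_cblinfun)
  then show ?thesis
    unfolding canonical_embedding_def
    by (subst cblinfun_apply_CBlinfun) (auto simp: cblinfun_apply_scaleC_left)
qed

lemma adjoint_map_apply:
  fixes T :: "'a::complex_normed_vector \<Rightarrow>\<^sub>C\<^sub>L 'b::complex_normed_vector"
  shows "cblinfun_apply (cblinfun_apply (adjoint_map T) f) x = cblinfun_apply f (cblinfun_apply T x)"
proof -
  define g :: "'b dual \<Rightarrow> 'a dual"
    where "g f = CBlinfun (\<lambda>x. cblinfun_apply f (cblinfun_apply T x))" for f
  have g: "cblinfun_apply (g f) x = cblinfun_apply f (cblinfun_apply T x)" for f x
    unfolding g_def
    by (subst cblinfun_apply_CBlinfun)
       (auto simp: cblinfun_apply_scaleC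
         intro!: bounded_linear_compose[OF bounded_linear_cblinfun_apply bounded_linear_cblinfun_apply])
  have "bounded_linear g"
  proof (rule bounded_linear_intro[where K="norm T"])
    fix f :: "'b dual"
    show "norm (g f) \<le> norm f * norm T"
    proof (rule norm_cblinfun_bound)
      fix x
      have "norm (cblinfun_apply f (cblinfun_apply T x)) \<le> norm f * norm (cblinfun_apply T x)"
        by (rule norm_cblinfun)
      also have "\<dots> \<le> norm f * (norm T * norm x)"
        by (intro mult_left_mono norm_cblinfun) auto
      finally show "norm (cblinfun_apply (g f) x) \<le> norm f * norm T * norm x"
        by (simp add: g mult.assoc)
    qed simp
  qed (auto intro!: cblinfun_eqI simp: g cblinfun_apply_add_left cblinfun_apply_scaleR_left)
  moreover have "g (c *\<^sub>C f) = c *\<^sub>C g f" for c f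
    by (rule cblinfun_eqI) (simp add: g cblinfun_apply_scaleC_left)
  ultimately have "cblinfun_apply (adjoint_map T) = g"
    unfolding adjoint_map_def g_def[abs_def] by (rule cblinfun_apply_CBlinfun)
  then show ?thesis by (simp add: g)
qed

lemma biadjoint_apply:
  "cblinfun_apply (cblinfun_apply (biadjoint T) M) f = cblinfun_apply M (cblinfun_apply (adjoint_map T) f)"
  unfolding biadjoint_def by (rule adjoint_map_apply)


section \<open>The algebraic tensor product\<close>

text \<open>The free complex vector space on \<open>X \<times> Y\<close>, modulo the bilinearity relations.\<close>

definition free_scale :: "complex \<Rightarrow> ('a \<Rightarrow>\<^sub>0 complex) \<Rightarrow> 'a \<Rightarrow>\<^sub>0 complex"
  where "free_scale c u = Poly_Mapping.map ((*) c) u"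

lemma lookup_free_scale [simp]: "Poly_Mapping.lookup (free_scale c u) k = c * Poly_Mapping.lookup u k"
  by (simp add: free_scale_def Poly_Mapping.map.rep_eq when_def)

lemma free_scale_simps:
  "free_scale c (u + v) = free_scale c u + free_scale c v"
  "free_scale c (u - v) = free_scale c u - free_scale c v"
  "free_scale (c + d) u = free_scale c u + free_scale d u"
  "free_scale c (free_scale d u) = free_scale (c * d) u"
  "free_scale 1 u = u"
  "free_scale (-1) u = - u"
  by (simp_all add: poly_mapping_eq_iff fun_eq_iff lookup_add lookup_minus
      distrib_left distrib_right right_diff_distrib)

lemma free_scale_single: "free_scale c (Poly_Mapping.single k d) = Poly_Mapping.single k (c * d)"
  by (simp add: free_scale_def)

inductive_set tensor_relations :: "(('a::complex_vector \<times> 'b::complex_vector) \<Rightarrow>\<^sub>0 complex) set"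
  where
    rel_zero: "0 \<in> tensor_relations"
  | rel_add: "u \<in> tensor_relations \<Longrightarrow> v \<in> tensor_relations \<Longrightarrow> u + v \<in> tensor_relations"
  | rel_scale: "u \<in> tensor_relations \<Longrightarrow> free_scale c u \<in> tensor_relations"
  | rel_add_left: "Poly_Mapping.single (x + x', y) 1
      - (Poly_Mapping.single (x, y) 1 + Poly_Mapping.single (x', y) 1) \<in> tensor_relations"
  | rel_add_right: "Poly_Mapping.single (x, y + y') 1
      - (Poly_Mapping.single (x, y) 1 + Poly_Mapping.single (x, y') 1) \<in> tensor_relations"
  | rel_scale_left: "Poly_Mapping.single (c *\<^sub>C x, y) 1
      - free_scale c (Poly_Mapping.single (x, y) 1) \<in> tensor_relations"
  | rel_scale_right: "Poly_Mapping.single (x, c *\<^sub>C y) 1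
      - free_scale c (Poly_Mapping.single (x, y) 1) \<in> tensor_relations"

lemma rel_uminus: "u \<in> tensor_relations \<Longrightarrow> - u \<in> tensor_relations"
  using rel_scale[of u "-1"] by (simp add: free_scale_simps)

lemma rel_diff: "u \<in> tensor_relations \<Longrightarrow> v \<in> tensor_relations \<Longrightarrow> u - v \<in> tensor_relations"
  using rel_add[of u "- v"] rel_uminus[of v] by simp

definition tensor_eq ::
    "(('a::complex_vector \<times> 'b::complex_vector) \<Rightarrow>\<^sub>0 complex) \<Rightarrow> (('a \<times> 'b) \<Rightarrow>\<^sub>0 complex) \<Rightarrow> bool"
  where "tensor_eq u v \<longleftrightarrow> u - v \<in> tensor_relations"

quotient_type (overloaded) ('a, 'b) alg_tensor =
  "('a::complex_vector \<times> 'b::complex_vector) \<Rightarrow>\<^sub>0 complex" / tensor_eq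
proof (rule equivpI)
  show "reflp tensor_eq"
    by (rule reflpI) (simp add: tensor_eq_def rel_zero)
  show "symp tensor_eq"
    by (rule sympI) (metis tensor_eq_def rel_uminus minus_diff_eq)
  show "transp tensor_eq"
  proof (rule transpI)
    fix u v w
    assume "tensor_eq u v" "tensor_eq v w"
    then have "(u - v) + (v - w) \<in> tensor_relations"
      unfolding tensor_eq_def by (rule rel_add)
    then show "tensor_eq u w" by (simp add: tensor_eq_def)
  qed
qed

instantiation alg_tensor :: (complex_vector, complex_vector) complex_vector
begin

lift_definition zero_alg_tensor :: "('a, 'b) alg_tensor" is 0 .

lift_definition plus_alg_tensor :: "('a, 'b) alg_tensor \<Rightarrow> ('a, 'b) alg_tensor \<Rightarrow> ('a, 'b) alg_tensor"
  is "(+)"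
  unfolding tensor_eq_def by (drule (1) rel_add) (simp add: algebra_simps)

lift_definition uminus_alg_tensor :: "('a, 'b) alg_tensor \<Rightarrow> ('a, 'b) alg_tensor"
  is uminus
  unfolding tensor_eq_def by (drule rel_uminus) (simp add: algebra_simps)

lift_definition minus_alg_tensor :: "('a, 'b) alg_tensor \<Rightarrow> ('a, 'b) alg_tensor \<Rightarrow> ('a, 'b) alg_tensor"
  is "(-)"
  unfolding tensor_eq_def by (drule (1) rel_diff) (simp add: algebra_simps)

lift_definition scaleC_alg_tensor :: "complex \<Rightarrow> ('a, 'b) alg_tensor \<Rightarrow> ('a, 'b) alg_tensor"
  is free_scale
  unfolding tensor_eq_def by (drule rel_scale) (simp add: free_scale_simps)

definition scaleR_alg_tensor :: "real \<Rightarrow> ('a, 'b) alg_tensor \<Rightarrow> ('a, 'b) alg_tensor"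
  where "scaleR_alg_tensor r u = complex_of_real r *\<^sub>C u"

instance
proof
  fix u v w :: "('a, 'b) alg_tensor" and c d :: complex and r s :: real
  have refl: "tensor_eq z z" for z :: "('a \<times> 'b) \<Rightarrow>\<^sub>0 complex"
    by (simp add: tensor_eq_def rel_zero)
  show "u + v + w = u + (v + w)" by transfer (simp add: add.assoc refl)
  show "u + v = v + u" by transfer (simp add: add.commute refl)
  show "0 + u = u" by transfer (simp add: refl)
  show "- u + u = 0" by transfer (simp add: refl)
  show "u - v = u + - v" by transfer (simp add: refl)
  show C1: "c *\<^sub>C (u + v) = c *\<^sub>C u + c *\<^sub>C v" for c by transfer (simp add: free_scale_simps refl)
  show C2: "(c + d) *\<^sub>C u = c *\<^sub>C u + d *\<^sub>C u" for c d by transfer (simp add: free_scale_simps refl)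
  show C3: "c *\<^sub>C d *\<^sub>C u = (c * d) *\<^sub>C u" for c d by transfer (simp add: free_scale_simps refl)
  show C4: "1 *\<^sub>C u = u" by transfer (simp add: free_scale_simps refl)
  show "r *\<^sub>R u = complex_of_real r *\<^sub>C u" by (rule scaleR_alg_tensor_def)
  show "r *\<^sub>R (u + v) = r *\<^sub>R u + r *\<^sub>R v" by (simp add: scaleR_alg_tensor_def C1)
  show "(r + s) *\<^sub>R u = r *\<^sub>R u + s *\<^sub>R u" by (simp add: scaleR_alg_tensor_def C2)
  show "r *\<^sub>R s *\<^sub>R u = (r * s) *\<^sub>R u" by (simp add: scaleR_alg_tensor_def C3)
  show "1 *\<^sub>R u = u" by (simp add: scaleR_alg_tensor_def C4)
qed

end

lift_definition alg_tensor_of :: "'a::complex_vector \<Rightarrow> 'b::complex_vector \<Rightarrow> ('a, 'b) alg_tensor"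
  is "\<lambda>x y. Poly_Mapping.single (x, y) 1" .

lemma alg_tensor_of_simps:
  "alg_tensor_of (x + x') y = alg_tensor_of x y + alg_tensor_of x' y"
  "alg_tensor_of x (y + y') = alg_tensor_of x y + alg_tensor_of x y'"
  "alg_tensor_of (c *\<^sub>C x) y = c *\<^sub>C alg_tensor_of x y"
  "alg_tensor_of x (c *\<^sub>C y) = c *\<^sub>C alg_tensor_of x y"
  by (transfer, simp only: tensor_eq_def rel_add_left rel_add_right rel_scale_left rel_scale_right)+

lemma alg_tensor_list:
  "\<exists>xs. u = (\<Sum>(x, y)\<leftarrow>xs. alg_tensor_of x y)" for u :: "('a::complex_vector, 'b::complex_vector) alg_tensor"
proof -
  have "\<exists>xs. abs_alg_tensor v = (\<Sum>(x, y)\<leftarrow>xs. alg_tensor_of x y)"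
    for v :: "('a \<times> 'b) \<Rightarrow>\<^sub>0 complex"
  proof (induction v rule: update_induct)
    case const
    then show ?case by (intro exI[of _ "[]"]) (simp add: zero_alg_tensor.abs_eq)
  next
    case (update v k c)
    obtain x y where k: "k = (x, y)" by (cases k)
    obtain xs where xs: "abs_alg_tensor v = (\<Sum>(x, y)\<leftarrow>xs. alg_tensor_of x y)"
      using update.IH by blast
    have "Poly_Mapping.update k c v = free_scale c (Poly_Mapping.single k 1) + v"
      using update.hyps
      by (intro poly_mapping_eqI)
         (auto simp: lookup_update lookup_add lookup_single when_def in_keys_iff)
    then have "abs_alg_tensor (Poly_Mapping.update k c v) = c *\<^sub>C alg_tensor_of x y + abs_alg_tensor v"
      by (simp add: k plus_alg_tensor.abs_eq scaleC_alg_tensor.abs_eq alg_tensor_of.abs_eq)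
    also have "\<dots> = (\<Sum>(x, y)\<leftarrow>(c *\<^sub>C x, y) # xs. alg_tensor_of x y)"
      by (simp add: xs alg_tensor_of_simps)
    finally show ?case by blast
  qed
  then show ?thesis
    by (induction u rule: alg_tensor.abs_induct) blast
qed


section \<open>The projective tensor product\<close>

subsection \<open>The projective norm\<close>

definition proj_norm :: "('a::complex_normed_vector, 'b::complex_normed_vector) alg_tensor \<Rightarrow> real"
  where "proj_norm u =
    Inf {(\<Sum>(x, y)\<leftarrow>xs. norm x * norm y) | xs. u = (\<Sum>(x, y)\<leftarrow>xs. alg_tensor_of x y)}"

lemma sum_list_norm_nonneg:
  "0 \<le> (\<Sum>(x, y)\<leftarrow>xs. norm x * norm y)"
  for xs :: "('a::complex_normed_vector \<times> 'b::complex_normed_vector) list"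
  by (rule sum_list_nonneg) auto

lemma proj_norm_le:
  "u = (\<Sum>(x, y)\<leftarrow>xs. alg_tensor_of x y) \<Longrightarrow> proj_norm u \<le> (\<Sum>(x, y)\<leftarrow>xs. norm x * norm y)"
  unfolding proj_norm_def
  by (rule cInf_lower) (auto intro!: bdd_belowI[of _ 0] sum_list_norm_nonneg)

lemma proj_norm_greatest:
  assumes "\<And>xs. u = (\<Sum>(x, y)\<leftarrow>xs. alg_tensor_of x y) \<Longrightarrow> b \<le> (\<Sum>(x, y)\<leftarrow>xs. norm x * norm y)"
  shows "b \<le> proj_norm u"
  unfolding proj_norm_def
  by (rule cInf_greatest) (use alg_tensor_list[of u] assms in auto)

lemma proj_norm_approx:
  assumes "0 < e"
  obtains xs where "u = (\<Sum>(x, y)\<leftarrow>xs. alg_tensor_of x y)"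
    and "(\<Sum>(x, y)\<leftarrow>xs. norm x * norm y) < proj_norm u + e"
proof -
  have "\<not> (\<forall>xs. u = (\<Sum>(x, y)\<leftarrow>xs. alg_tensor_of x y) \<longrightarrow>
      proj_norm u + e \<le> (\<Sum>(x, y)\<leftarrow>xs. norm x * norm y))"
    using proj_norm_greatest[of u "proj_norm u + e"] assms by fastforce
  then show ?thesis using that by (auto simp: not_le)
qed

lemma proj_norm_nonneg [simp]: "0 \<le> proj_norm u"
  by (rule proj_norm_greatest) (rule sum_list_norm_nonneg)

lemma proj_norm_zero [simp]: "proj_norm 0 = 0"
  by (rule antisym) (use proj_norm_le[of 0 "[]"] in auto)

lemma proj_norm_triangle: "proj_norm (u + v) \<le> proj_norm u + proj_norm v"
proof (rule field_le_epsilon)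
  fix e :: real assume "0 < e"
  then have "0 < e / 2" by simp
  obtain xs where xs: "u = (\<Sum>(x, y)\<leftarrow>xs. alg_tensor_of x y)"
      "(\<Sum>(x, y)\<leftarrow>xs. norm x * norm y) < proj_norm u + e / 2"
    using \<open>0 < e / 2\<close> by (rule proj_norm_approx)
  obtain ys where ys: "v = (\<Sum>(x, y)\<leftarrow>ys. alg_tensor_of x y)"
      "(\<Sum>(x, y)\<leftarrow>ys. norm x * norm y) < proj_norm v + e / 2"
    using \<open>0 < e / 2\<close> by (rule proj_norm_approx)
  have "proj_norm (u + v) \<le> (\<Sum>(x, y)\<leftarrow>xs @ ys. norm x * norm y)"
    by (rule proj_norm_le) (simp add: xs ys)
  with xs(2) ys(2) show "proj_norm (u + v) \<le> proj_norm u + proj_norm v + e"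
    by simp
qed

lemma proj_norm_scaleC_le: "proj_norm (c *\<^sub>C u) \<le> cmod c * proj_norm u"
proof (cases "c = 0")
  case False
  have "proj_norm (c *\<^sub>C u) / cmod c \<le> proj_norm u"
  proof (rule proj_norm_greatest)
    fix xs assume u: "u = (\<Sum>(x, y)\<leftarrow>xs. alg_tensor_of x y)"
    have 1: "c *\<^sub>C (\<Sum>(x, y)\<leftarrow>xs. alg_tensor_of x y)
        = (\<Sum>(x, y)\<leftarrow>map (\<lambda>(x, y). (c *\<^sub>C x, y)) xs. alg_tensor_of x y)"
      by (induction xs) (auto simp: scaleC_add_right alg_tensor_of_simps)
    have 2: "(\<Sum>(x, y)\<leftarrow>map (\<lambda>(x, y). (c *\<^sub>C x, y)) xs. norm x * norm y)
        = cmod c * (\<Sum>(x, y)\<leftarrow>xs. norm x * norm y)"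
      by (induction xs) (auto simp: norm_scaleC algebra_simps)
    show "proj_norm (c *\<^sub>C u) / cmod c \<le> (\<Sum>(x, y)\<leftarrow>xs. norm x * norm y)"
      using proj_norm_le[OF 1] False unfolding u 2 by (simp add: field_simps)
  qed
  then show ?thesis using False by (simp add: field_simps)
qed simp

lemma proj_norm_scaleC: "proj_norm (c *\<^sub>C u) = cmod c * proj_norm u"
proof (cases "c = 0")
  case False
  have "proj_norm u \<le> inverse (cmod c) * proj_norm (c *\<^sub>C u)"
    using proj_norm_scaleC_le[of "inverse c" "c *\<^sub>C u"] False
    by (simp add: scaleC_scaleC scaleC_one norm_inverse)
  then have "cmod c * proj_norm u \<le> proj_norm (c *\<^sub>C u)"
    using False by (simp add: field_simps)
  with proj_norm_scaleC_le[of c u] show ?thesis by simp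
qed simp

lemma proj_norm_uminus [simp]: "proj_norm (- u) = proj_norm u"
  using proj_norm_scaleC[of "-1" u] by (simp add: scaleC_minus_one)

lemma proj_norm_minus_commute: "proj_norm (u - v) = proj_norm (v - u)"
  by (metis proj_norm_uminus minus_diff_eq)

lemma proj_norm_diff_triangle: "proj_norm (u - w) \<le> proj_norm (u - v) + proj_norm (v - w)"
  using proj_norm_triangle[of "u - v" "v - w"] by simp

lemma proj_norm_triangle3: "\<bar>proj_norm u - proj_norm v\<bar> \<le> proj_norm (u - v)"
  using proj_norm_triangle[of "u - v" v] proj_norm_triangle[of "v - u" u]
    proj_norm_minus_commute[of u v] by simp

lemma proj_norm_tensor_le: "proj_norm (alg_tensor_of x y) \<le> norm x * norm y"
  using proj_norm_le[of "alg_tensor_of x y" "[(x, y)]"] by simp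


subsection \<open>Completion\<close>

text \<open>The elements are the Cauchy sequences for \<^const>\<open>proj_norm\<close> modulo null sequences. This
  is the completion of the normed space obtained from \<^const>\<open>proj_norm\<close>; definiteness of
  \<^const>\<open>proj_norm\<close> is not needed for the construction.\<close>

definition proj_Cauchy ::
    "(nat \<Rightarrow> ('a::complex_normed_vector, 'b::complex_normed_vector) alg_tensor) \<Rightarrow> bool"
  where "proj_Cauchy X \<longleftrightarrow> (\<forall>e>0. \<exists>N. \<forall>m\<ge>N. \<forall>n\<ge>N. proj_norm (X m - X n) < e)"

definition proj_eq ::
    "(nat \<Rightarrow> ('a::complex_normed_vector, 'b::complex_normed_vector) alg_tensor) \<Rightarrow>
     (nat \<Rightarrow> ('a, 'b) alg_tensor) \<Rightarrow> bool"
  where "proj_eq X Y \<longleftrightarrow>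
    proj_Cauchy X \<and> proj_Cauchy Y \<and> (\<lambda>n. proj_norm (X n - Y n)) \<longlonglongrightarrow> 0"

lemma proj_null_bound:
  assumes "\<And>n. proj_norm (Z n) \<le> f n" "f \<longlonglongrightarrow> 0"
  shows "(\<lambda>n. proj_norm (Z n)) \<longlonglongrightarrow> 0"
  by (rule tendsto_sandwich[OF _ _ tendsto_const assms(2)]) (auto simp: assms(1))

lemma proj_Cauchy_const: "proj_Cauchy (\<lambda>_. u)"
  unfolding proj_Cauchy_def by simp

lemma proj_Cauchy_bound:
  assumes "proj_Cauchy X" "0 \<le> K" "\<And>m n. proj_norm (Z m - Z n) \<le> K * proj_norm (X m - X n)"
  shows "proj_Cauchy Z"
  unfolding proj_Cauchy_def
proof (intro allI impI)
  fix e :: real assume "0 < e"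
  then have "0 < e / (K + 1)" using assms(2) by simp
  then obtain N where N: "\<And>m n. m \<ge> N \<Longrightarrow> n \<ge> N \<Longrightarrow> proj_norm (X m - X n) < e / (K + 1)"
    using assms(1) unfolding proj_Cauchy_def by meson
  have "proj_norm (Z m - Z n) < e" if "m \<ge> N" "n \<ge> N" for m n
  proof -
    have "proj_norm (Z m - Z n) \<le> K * proj_norm (X m - X n)" by (rule assms(3))
    also have "\<dots> \<le> K * (e / (K + 1))"
      by (intro mult_left_mono less_imp_le N that assms(2))
    also have "\<dots> < e" using assms(2) \<open>0 < e\<close> by (simp add: field_simps)
    finally show ?thesis .
  qed
  then show "\<exists>N. \<forall>m\<ge>N. \<forall>n\<ge>N. proj_norm (Z m - Z n) < e" by blast
qed

lemma proj_Cauchy_add: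
  assumes "proj_Cauchy X" "proj_Cauchy Y"
  shows "proj_Cauchy (\<lambda>n. X n + Y n)"
  unfolding proj_Cauchy_def
proof (intro allI impI)
  fix e :: real assume "0 < e"
  then have "0 < e / 2" by simp
  obtain M where M: "\<And>m n. m \<ge> M \<Longrightarrow> n \<ge> M \<Longrightarrow> proj_norm (X m - X n) < e / 2"
    using assms(1) \<open>0 < e / 2\<close> unfolding proj_Cauchy_def by meson
  obtain N where N: "\<And>m n. m \<ge> N \<Longrightarrow> n \<ge> N \<Longrightarrow> proj_norm (Y m - Y n) < e / 2"
    using assms(2) \<open>0 < e / 2\<close> unfolding proj_Cauchy_def by meson
  have "proj_norm ((X m + Y m) - (X n + Y n)) < e" if "m \<ge> max M N" "n \<ge> max M N" for m n
  proof -
    have "proj_norm ((X m + Y m) - (X n + Y n)) \<le> proj_norm (X m - X n) + proj_norm (Y m - Y n)"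
      using proj_norm_triangle[of "X m - X n" "Y m - Y n"] by (simp add: add_diff_add)
    also have "\<dots> < e" using M[of m n] N[of m n] that by simp
    finally show ?thesis .
  qed
  then show "\<exists>N. \<forall>m\<ge>N. \<forall>n\<ge>N. proj_norm ((X m + Y m) - (X n + Y n)) < e" by blast
qed

lemma proj_Cauchy_scaleC: "proj_Cauchy X \<Longrightarrow> proj_Cauchy (\<lambda>n. c *\<^sub>C X n)"
  by (rule proj_Cauchy_bound[where K="cmod c"])
     (auto simp: scaleC_diff_right[symmetric] proj_norm_scaleC)

lemma proj_Cauchy_uminus: "proj_Cauchy X \<Longrightarrow> proj_Cauchy (\<lambda>n. - X n)"
  using proj_Cauchy_scaleC[of X "-1"] by (simp add: scaleC_minus_one)

lemma proj_Cauchy_convergent: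
  assumes "proj_Cauchy X"
  shows "convergent (\<lambda>n. proj_norm (X n))"
proof -
  have "Cauchy (\<lambda>n. proj_norm (X n))"
    unfolding Cauchy_def dist_real_def
  proof (intro allI impI)
    fix e :: real assume "0 < e"
    then obtain N where "\<And>m n. m \<ge> N \<Longrightarrow> n \<ge> N \<Longrightarrow> proj_norm (X m - X n) < e"
      using assms unfolding proj_Cauchy_def by meson
    then show "\<exists>N. \<forall>m\<ge>N. \<forall>n\<ge>N. \<bar>proj_norm (X m) - proj_norm (X n)\<bar> < e"
      by (meson proj_norm_triangle3 le_less_trans)
  qed
  then show ?thesis by (simp add: Cauchy_convergent_iff)
qed

lemma part_equivp_proj_eq: "part_equivp proj_eq"
proof (rule part_equivpI)
  show "\<exists>X. proj_eq X X"
    by (rule exI[of _ "\<lambda>_. 0"]) (simp add: proj_eq_def proj_Cauchy_const)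
  show "symp proj_eq"
    by (rule sympI) (simp add: proj_eq_def proj_norm_minus_commute)
  show "transp proj_eq"
  proof (rule transpI)
    fix X Y Z assume XY: "proj_eq X Y" and YZ: "proj_eq Y Z"
    have "(\<lambda>n. proj_norm (X n - Y n) + proj_norm (Y n - Z n)) \<longlonglongrightarrow> 0"
      using tendsto_add[of _ 0 _ _ 0] XY YZ unfolding proj_eq_def by auto
    then have "(\<lambda>n. proj_norm (X n - Z n)) \<longlonglongrightarrow> 0"
      by (rule proj_null_bound[rotated]) (rule proj_norm_diff_triangle)
    with XY YZ show "proj_eq X Z" by (simp add: proj_eq_def)
  qed
qed

quotient_type (overloaded) ('a, 'b) proj_tensor =
  "nat \<Rightarrow> ('a::complex_normed_vector, 'b::complex_normed_vector) alg_tensor" / partial: proj_eq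
  by (rule part_equivp_proj_eq)

lemma abs_proj_tensor_eq_iff:
  "proj_Cauchy X \<Longrightarrow> proj_Cauchy Y \<Longrightarrow>
    abs_proj_tensor X = abs_proj_tensor Y \<longleftrightarrow> (\<lambda>n. proj_norm (X n - Y n)) \<longlonglongrightarrow> 0"
  using Quotient3_rel[OF Quotient3_proj_tensor, of X Y] by (simp add: proj_eq_def)

lemma proj_tensor_exhaust:
  obtains X where "proj_Cauchy X" "u = abs_proj_tensor X"
proof -
  have "\<exists>X. proj_Cauchy X \<and> u = abs_proj_tensor X"
    by (induction u rule: proj_tensor.abs_induct) (auto simp: proj_eq_def)
  then show ?thesis using that by blast
qed

instantiation proj_tensor :: (complex_normed_vector, complex_normed_vector) complex_normed_vector
begin

lift_definition zero_proj_tensor :: "('a, 'b) proj_tensor" is "\<lambda>_. 0"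
  by (simp add: proj_eq_def proj_Cauchy_const)

lift_definition plus_proj_tensor ::
    "('a, 'b) proj_tensor \<Rightarrow> ('a, 'b) proj_tensor \<Rightarrow> ('a, 'b) proj_tensor"
  is "\<lambda>X Y n. X n + Y n"
proof -
  fix X X' Y Y' :: "nat \<Rightarrow> ('a, 'b) alg_tensor"
  assume X: "proj_eq X X'" and Y: "proj_eq Y Y'"
  have "(\<lambda>n. proj_norm (X n - X' n) + proj_norm (Y n - Y' n)) \<longlonglongrightarrow> 0"
    using tendsto_add[of _ 0 _ _ 0] X Y unfolding proj_eq_def by auto
  then have "(\<lambda>n. proj_norm ((X n + Y n) - (X' n + Y' n))) \<longlonglongrightarrow> 0"
    by (rule proj_null_bound[rotated]) (simp add: add_diff_add proj_norm_triangle)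
  with X Y show "proj_eq (\<lambda>n. X n + Y n) (\<lambda>n. X' n + Y' n)"
    by (simp add: proj_eq_def proj_Cauchy_add)
qed

lift_definition scaleC_proj_tensor :: "complex \<Rightarrow> ('a, 'b) proj_tensor \<Rightarrow> ('a, 'b) proj_tensor"
  is "\<lambda>c X n. c *\<^sub>C X n"
proof -
  fix c and X X' :: "nat \<Rightarrow> ('a, 'b) alg_tensor"
  assume X: "proj_eq X X'"
  then have "(\<lambda>n. cmod c * proj_norm (X n - X' n)) \<longlonglongrightarrow> 0"
    unfolding proj_eq_def by (auto intro: tendsto_mult_right_zero)
  with X show "proj_eq (\<lambda>n. c *\<^sub>C X n) (\<lambda>n. c *\<^sub>C X' n)"
    by (simp add: proj_eq_def proj_Cauchy_scaleC scaleC_diff_right[symmetric] proj_norm_scaleC)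
qed

definition uminus_proj_tensor :: "('a, 'b) proj_tensor \<Rightarrow> ('a, 'b) proj_tensor"
  where "uminus_proj_tensor u = (-1) *\<^sub>C u"

definition minus_proj_tensor ::
    "('a, 'b) proj_tensor \<Rightarrow> ('a, 'b) proj_tensor \<Rightarrow> ('a, 'b) proj_tensor"
  where "minus_proj_tensor u v = u + (-1) *\<^sub>C v"

definition scaleR_proj_tensor :: "real \<Rightarrow> ('a, 'b) proj_tensor \<Rightarrow> ('a, 'b) proj_tensor"
  where "scaleR_proj_tensor r u = complex_of_real r *\<^sub>C u"

lift_definition norm_proj_tensor :: "('a, 'b) proj_tensor \<Rightarrow> real"
  is "\<lambda>X. lim (\<lambda>n. proj_norm (X n))"
proof -
  fix X Y :: "nat \<Rightarrow> ('a, 'b) alg_tensor"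
  assume XY: "proj_eq X Y"
  then obtain l where l: "(\<lambda>n. proj_norm (X n)) \<longlonglongrightarrow> l"
    using proj_Cauchy_convergent unfolding proj_eq_def convergent_def by blast
  have "(\<lambda>n. proj_norm (Y n) - proj_norm (X n)) \<longlonglongrightarrow> 0"
    by (rule tendsto_rabs_zero_cancel,
        rule tendsto_sandwich[OF _ _ tendsto_const, where h="\<lambda>n. proj_norm (X n - Y n)"])
       (use XY in \<open>auto simp: proj_eq_def abs_minus_commute proj_norm_triangle3\<close>)
  from tendsto_add[OF this l] have "(\<lambda>n. proj_norm (Y n)) \<longlonglongrightarrow> l" by simp
  with l show "lim (\<lambda>n. proj_norm (X n)) = lim (\<lambda>n. proj_norm (Y n))"
    by (simp add: limI)
qed

definition dist_proj_tensor :: "('a, 'b) proj_tensor \<Rightarrow> ('a, 'b) proj_tensor \<Rightarrow> real"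
  where "dist_proj_tensor u v = norm (u - v)"

definition sgn_proj_tensor :: "('a, 'b) proj_tensor \<Rightarrow> ('a, 'b) proj_tensor"
  where "sgn_proj_tensor u = scaleR (inverse (norm u)) u"

definition uniformity_proj_tensor :: "(('a, 'b) proj_tensor \<times> ('a, 'b) proj_tensor) filter"
  where "uniformity_proj_tensor = (INF e\<in>{0 <..}. principal {(x, y). dist x y < e})"

definition open_proj_tensor :: "('a, 'b) proj_tensor set \<Rightarrow> bool"
  where "open_proj_tensor S = (\<forall>x\<in>S. \<forall>\<^sub>F (x', y) in uniformity. x' = x \<longrightarrow> y \<in> S)"

lemma zero_abs: "(0 :: ('a, 'b) proj_tensor) = abs_proj_tensor (\<lambda>_. 0)"
  by (rule zero_proj_tensor.abs_eq)

lemma plus_abs: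
  fixes X Y :: "nat \<Rightarrow> ('a, 'b) alg_tensor"
  shows "proj_Cauchy X \<Longrightarrow> proj_Cauchy Y \<Longrightarrow>
    abs_proj_tensor X + abs_proj_tensor Y = abs_proj_tensor (\<lambda>n. X n + Y n)"
  by (rule plus_proj_tensor.abs_eq) (simp_all add: proj_eq_def)

lemma scaleC_abs:
  fixes X :: "nat \<Rightarrow> ('a, 'b) alg_tensor"
  shows "proj_Cauchy X \<Longrightarrow> c *\<^sub>C abs_proj_tensor X = abs_proj_tensor (\<lambda>n. c *\<^sub>C X n)"
  by (rule scaleC_proj_tensor.abs_eq) (simp add: proj_eq_def)

lemma norm_abs:
  fixes X :: "nat \<Rightarrow> ('a, 'b) alg_tensor"
  shows "proj_Cauchy X \<Longrightarrow> norm (abs_proj_tensor X) = lim (\<lambda>n. proj_norm (X n))"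
  by (rule norm_proj_tensor.abs_eq) (simp add: proj_eq_def)

lemma proj_norm_lim: "proj_Cauchy X \<Longrightarrow> (\<lambda>n. proj_norm (X n)) \<longlonglongrightarrow> lim (\<lambda>n. proj_norm (X n))"
  for X :: "nat \<Rightarrow> ('a, 'b) alg_tensor"
  by (simp add: convergent_LIMSEQ_iff[symmetric] proj_Cauchy_convergent)

instance
proof
  fix u v w :: "('a, 'b) proj_tensor" and c d :: complex and r s :: real
  obtain X where X: "proj_Cauchy X" "u = abs_proj_tensor X" by (rule proj_tensor_exhaust)
  obtain Y where Y: "proj_Cauchy Y" "v = abs_proj_tensor Y" by (rule proj_tensor_exhaust)
  obtain Z where Z: "proj_Cauchy Z" "w = abs_proj_tensor Z" by (rule proj_tensor_exhaust)
  note abs_eqs = X(2) Y(2) Z(2) zero_abs plus_abs scaleC_abs norm_abs X(1) Y(1) Z(1)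
    proj_Cauchy_add proj_Cauchy_scaleC
  show "u + v + w = u + (v + w)" by (simp add: abs_eqs add.assoc)
  show "u + v = v + u" by (simp add: abs_eqs add.commute)
  show "0 + u = u" by (simp add: abs_eqs proj_Cauchy_const)
  show "- u + u = 0"
    unfolding uminus_proj_tensor_def X(2) scaleC_abs[OF X(1)]
      plus_abs[OF proj_Cauchy_scaleC[OF X(1)] X(1)]
    by (simp add: scaleC_minus_one[where 'a="('a, 'b) alg_tensor"] zero_abs)
  show "u - v = u + - v"
    by (simp add: minus_proj_tensor_def uminus_proj_tensor_def)
  show C1: "c *\<^sub>C (u + v) = c *\<^sub>C u + c *\<^sub>C v" for c
    unfolding X(2) Y(2) plus_abs[OF X(1) Y(1)] scaleC_abs[OF X(1)] scaleC_abs[OF Y(1)]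
      scaleC_abs[OF proj_Cauchy_add[OF X(1) Y(1)]]
      plus_abs[OF proj_Cauchy_scaleC[OF X(1)] proj_Cauchy_scaleC[OF Y(1)]]
    by (simp only: scaleC_add_right)
  show C2: "(c + d) *\<^sub>C u = c *\<^sub>C u + d *\<^sub>C u" for c d
    unfolding X(2) scaleC_abs[OF X(1)]
      plus_abs[OF proj_Cauchy_scaleC[OF X(1)] proj_Cauchy_scaleC[OF X(1)]]
    by (simp only: scaleC_add_left)
  show C3: "c *\<^sub>C d *\<^sub>C u = (c * d) *\<^sub>C u" for c d
    unfolding X(2) scaleC_abs[OF X(1)] scaleC_abs[OF proj_Cauchy_scaleC[OF X(1)]]
    by (simp only: scaleC_scaleC)
  show C4: "1 *\<^sub>C u = u"
    unfolding X(2) scaleC_abs[OF X(1)] by (simp only: scaleC_one)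
  show "r *\<^sub>R u = complex_of_real r *\<^sub>C u" by (rule scaleR_proj_tensor_def)
  show "r *\<^sub>R (u + v) = r *\<^sub>R u + r *\<^sub>R v" by (simp add: scaleR_proj_tensor_def C1)
  show "(r + s) *\<^sub>R u = r *\<^sub>R u + s *\<^sub>R u" by (simp add: scaleR_proj_tensor_def C2)
  show "r *\<^sub>R s *\<^sub>R u = (r * s) *\<^sub>R u" by (simp add: scaleR_proj_tensor_def C3)
  show "1 *\<^sub>R u = u" by (simp add: scaleR_proj_tensor_def C4)
  show "dist u v = norm (u - v)" by (rule dist_proj_tensor_def)
  show "sgn u = inverse (norm u) *\<^sub>R u" by (rule sgn_proj_tensor_def)
  show "(uniformity :: (('a, 'b) proj_tensor \<times> ('a, 'b) proj_tensor) filter)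
      = (INF e\<in>{0 <..}. principal {(x, y). dist x y < e})"
    by (rule uniformity_proj_tensor_def)
  show "open U = (\<forall>x\<in>U. \<forall>\<^sub>F (x', y) in uniformity. x' = x \<longrightarrow> y \<in> U)" for U :: "('a, 'b) proj_tensor set"
    by (rule open_proj_tensor_def)
  show "(norm u = 0) = (u = 0)"
  proof -
    have L: "(\<lambda>n. proj_norm (X n)) \<longlonglongrightarrow> norm u"
      using proj_norm_lim[OF X(1)] unfolding X(2) norm_abs[OF X(1)] .
    have "u = 0 \<longleftrightarrow> (\<lambda>n. proj_norm (X n - 0)) \<longlonglongrightarrow> 0"
      unfolding X(2) zero_abs by (rule abs_proj_tensor_eq_iff[OF X(1) proj_Cauchy_const])
    then have "u = 0 \<longleftrightarrow> (\<lambda>n. proj_norm (X n)) \<longlonglongrightarrow> 0"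
      by (simp only: diff_zero)
    with L show ?thesis by (metis LIMSEQ_unique)
  qed
  show "norm (u + v) \<le> norm u + norm v"
    unfolding X(2) Y(2) plus_abs[OF X(1) Y(1)] norm_abs[OF X(1)] norm_abs[OF Y(1)]
      norm_abs[OF proj_Cauchy_add[OF X(1) Y(1)]]
    by (rule LIMSEQ_le[OF proj_norm_lim[OF proj_Cauchy_add[OF X(1) Y(1)]]
          tendsto_add[OF proj_norm_lim[OF X(1)] proj_norm_lim[OF Y(1)]]])
       (simp add: proj_norm_triangle)
  show N: "norm (c *\<^sub>C u) = cmod c * norm u" for c
    using tendsto_mult_left[OF proj_norm_lim[OF X(1)], of "cmod c"]
    by (simp add: abs_eqs proj_norm_scaleC limI)
  show "norm (r *\<^sub>R u) = \<bar>r\<bar> * norm u"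
    by (simp add: scaleR_proj_tensor_def N)
qed

end

definition of_alg_tensor ::
    "('a::complex_normed_vector, 'b::complex_normed_vector) alg_tensor \<Rightarrow> ('a, 'b) proj_tensor"
  where "of_alg_tensor u = abs_proj_tensor (\<lambda>_. u)"

definition tensor ::
    "'a::complex_normed_vector \<Rightarrow> 'b::complex_normed_vector \<Rightarrow> ('a, 'b) proj_tensor"
    (infixr \<open>\<otimes>\<^sub>p\<close> 72)
  where "x \<otimes>\<^sub>p y = of_alg_tensor (alg_tensor_of x y)"

lemma of_alg_tensor_simps:
  "of_alg_tensor 0 = 0"
  "of_alg_tensor (u + v) = of_alg_tensor u + of_alg_tensor v"
  "of_alg_tensor (c *\<^sub>C u) = c *\<^sub>C of_alg_tensor u"
  by (simp_all add: of_alg_tensor_def zero_abs plus_abs scaleC_abs proj_Cauchy_const)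

lemma of_alg_tensor_diff: "of_alg_tensor (u - v) = of_alg_tensor u - of_alg_tensor v"
  using of_alg_tensor_simps(2)[of "u - v" v] by simp

lemma norm_of_alg_tensor: "norm (of_alg_tensor u) = proj_norm u"
  by (simp add: of_alg_tensor_def norm_abs proj_Cauchy_const limI)

lemma norm_tensor_le: "norm (x \<otimes>\<^sub>p y) \<le> norm x * norm y"
  by (simp add: tensor_def norm_of_alg_tensor proj_norm_tensor_le)

lemma tensor_simps:
  "(x + x') \<otimes>\<^sub>p y = x \<otimes>\<^sub>p y + x' \<otimes>\<^sub>p y"
  "x \<otimes>\<^sub>p (y + y') = x \<otimes>\<^sub>p y + x \<otimes>\<^sub>p y'"
  "(c *\<^sub>C x) \<otimes>\<^sub>p y = c *\<^sub>C (x \<otimes>\<^sub>p y)"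
  "x \<otimes>\<^sub>p (c *\<^sub>C y) = c *\<^sub>C (x \<otimes>\<^sub>p y)"
  by (simp_all add: tensor_def alg_tensor_of_simps of_alg_tensor_simps)

lemma of_alg_tensor_sum_list:
  "of_alg_tensor (\<Sum>(x, y)\<leftarrow>xs. alg_tensor_of x y) = (\<Sum>(x, y)\<leftarrow>xs. x \<otimes>\<^sub>p y)"
  by (induction xs) (auto simp: of_alg_tensor_simps tensor_def)

lemma of_alg_tensor_LIMSEQ:
  assumes "proj_Cauchy X"
  shows "(\<lambda>n. of_alg_tensor (X n)) \<longlonglongrightarrow> abs_proj_tensor X"
proof (rule LIMSEQ_I)
  fix e :: real assume "0 < e"
  then have "0 < e / 2" by simp
  then obtain N where N: "\<And>m n. m \<ge> N \<Longrightarrow> n \<ge> N \<Longrightarrow> proj_norm (X m - X n) < e / 2"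
    using assms unfolding proj_Cauchy_def by meson
  have "norm (of_alg_tensor (X m) - abs_proj_tensor X) < e" if "m \<ge> N" for m
  proof -
    have C: "proj_Cauchy (\<lambda>n. X m + (-1) *\<^sub>C X n)"
      by (intro proj_Cauchy_add proj_Cauchy_const proj_Cauchy_scaleC assms)
    have "of_alg_tensor (X m) - abs_proj_tensor X = abs_proj_tensor (\<lambda>n. X m + (-1) *\<^sub>C X n)"
      by (simp add: minus_proj_tensor_def of_alg_tensor_def scaleC_abs plus_abs
          proj_Cauchy_const proj_Cauchy_scaleC assms)
    then have "norm (of_alg_tensor (X m) - abs_proj_tensor X) = lim (\<lambda>n. proj_norm (X m - X n))"
      using C by (simp add: norm_abs scaleC_minus_one)
    also have "\<dots> \<le> e / 2"
    proof (rule LIMSEQ_le_const2)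
      show "(\<lambda>n. proj_norm (X m - X n)) \<longlonglongrightarrow> lim (\<lambda>n. proj_norm (X m - X n))"
        using proj_norm_lim[OF C] by (simp add: scaleC_minus_one)
      show "\<exists>N. \<forall>n\<ge>N. proj_norm (X m - X n) \<le> e / 2"
        using N that by (meson less_imp_le)
    qed
    also have "\<dots> < e" using \<open>0 < e\<close> by simp
    finally show ?thesis .
  qed
  then show "\<exists>N. \<forall>n\<ge>N. norm (of_alg_tensor (X n) - abs_proj_tensor X) < e" by blast
qed

lemma of_alg_tensor_dense:
  assumes "0 < e"
  obtains v where "norm (u - of_alg_tensor v) < e"
proof -
  obtain X where X: "proj_Cauchy X" "u = abs_proj_tensor X" by (rule proj_tensor_exhaust)
  then obtain n where "norm (of_alg_tensor (X n) - u) < e"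
    using LIMSEQ_D[OF of_alg_tensor_LIMSEQ[OF X(1)] assms] by blast
  then show ?thesis using that by (simp add: norm_minus_commute)
qed

instance proj_tensor :: (complex_normed_vector, complex_normed_vector) banach
proof
  fix U :: "nat \<Rightarrow> ('a, 'b) proj_tensor"
  assume U: "Cauchy U"
  have "\<exists>v. norm (U n - of_alg_tensor v) < 1 / (real n + 1)" for n
    by (rule of_alg_tensor_dense[of "1 / (real n + 1)" "U n"]) auto
  then obtain X where X: "\<And>n. norm (U n - of_alg_tensor (X n)) < 1 / (real n + 1)"
    by metis
  have null: "(\<lambda>n. U n - of_alg_tensor (X n)) \<longlonglongrightarrow> 0"
  proof (rule tendsto_norm_zero_cancel, rule tendsto_sandwich[OF _ _ tendsto_const])
    show "\<forall>\<^sub>F n in sequentially. norm (U n - of_alg_tensor (X n)) \<le> inverse (real (Suc n))"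
      using X by (intro always_eventually allI less_imp_le) (simp add: inverse_eq_divide add.commute)
    show "(\<lambda>n. inverse (real (Suc n))) \<longlonglongrightarrow> 0" by (rule LIMSEQ_inverse_real_of_nat)
  qed auto
  have "Cauchy (\<lambda>n. of_alg_tensor (X n))"
  proof (rule metric_CauchyI)
    fix e :: real assume "0 < e"
    then have "0 < e / 3" by simp
    obtain M where M: "\<And>m n. m \<ge> M \<Longrightarrow> n \<ge> M \<Longrightarrow> dist (U m) (U n) < e / 3"
      using metric_CauchyD[OF U \<open>0 < e / 3\<close>] by blast
    obtain N where "\<forall>n\<ge>N. norm (U n - of_alg_tensor (X n) - 0) < e / 3"
      using LIMSEQ_D[OF null \<open>0 < e / 3\<close>] by blast
    then have N: "\<And>n. n \<ge> N \<Longrightarrow> dist (U n) (of_alg_tensor (X n)) < e / 3"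
      by (simp add: dist_norm)
    have "dist (of_alg_tensor (X m)) (of_alg_tensor (X n)) < e" if "m \<ge> max M N" "n \<ge> max M N" for m n
    proof -
      have "dist (of_alg_tensor (X m)) (of_alg_tensor (X n))
          \<le> dist (U m) (of_alg_tensor (X m)) + dist (U m) (of_alg_tensor (X n))"
        by (rule dist_triangle3)
      also have "dist (U m) (of_alg_tensor (X n)) \<le> dist (U m) (U n) + dist (U n) (of_alg_tensor (X n))"
        by (rule dist_triangle)
      finally show ?thesis using M[of m n] N[of m] N[of n] that by simp
    qed
    then show "\<exists>M. \<forall>m\<ge>M. \<forall>n\<ge>M. dist (of_alg_tensor (X m)) (of_alg_tensor (X n)) < e" by blast
  qed
  then have "proj_Cauchy X"
    unfolding Cauchy_def proj_Cauchy_def dist_norm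
    by (simp add: of_alg_tensor_diff[symmetric] norm_of_alg_tensor)
  from tendsto_add[OF null of_alg_tensor_LIMSEQ[OF this]] show "convergent U"
    by (auto simp: convergent_def)
qed


subsection \<open>The bounded linear map determined by a bounded bilinear map\<close>

definition bounded_cbilinear ::
    "('a::complex_normed_vector \<Rightarrow> 'b::complex_normed_vector \<Rightarrow> 'c::complex_normed_vector) \<Rightarrow> bool"
  where "bounded_cbilinear \<phi> \<longleftrightarrow> bounded_bilinear \<phi> \<and>
    (\<forall>c x y. \<phi> (c *\<^sub>C x) y = c *\<^sub>C \<phi> x y) \<and> (\<forall>c x y. \<phi> x (c *\<^sub>C y) = c *\<^sub>C \<phi> x y)"

definition proj_lift ::
    "('a::complex_normed_vector \<Rightarrow> 'b::complex_normed_vector \<Rightarrow> 'c::complex_normed_vector) \<Rightarrow>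
     ('a, 'b) proj_tensor \<Rightarrow>\<^sub>C\<^sub>L 'c"
  where "proj_lift \<phi> = (THE T. \<forall>x y. cblinfun_apply T (x \<otimes>\<^sub>p y) = \<phi> x y)"

lemma cblinfun_apply_add: "cblinfun_apply T (u + v) = cblinfun_apply T u + cblinfun_apply T v"
  by (rule linear_add[OF bounded_linear.linear[OF bounded_linear_cblinfun_apply]])

lemma cblinfun_apply_zero [simp]: "cblinfun_apply T 0 = 0"
  by (rule linear_0[OF bounded_linear.linear[OF bounded_linear_cblinfun_apply]])

lemma proj_tensor_cblinfun_eqI:
  fixes S T :: "('a::complex_normed_vector, 'b::complex_normed_vector) proj_tensor \<Rightarrow>\<^sub>C\<^sub>L 'c::complex_normed_vector"
  assumes "\<And>x y. cblinfun_apply S (x \<otimes>\<^sub>p y) = cblinfun_apply T (x \<otimes>\<^sub>p y)"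
  shows "S = T"
proof (rule cblinfun_eqI)
  fix u :: "('a, 'b) proj_tensor"
  obtain X where X: "proj_Cauchy X" "u = abs_proj_tensor X" by (rule proj_tensor_exhaust)
  have eq: "cblinfun_apply S (of_alg_tensor v) = cblinfun_apply T (of_alg_tensor v)"
    for v :: "('a, 'b) alg_tensor"
  proof -
    obtain xs where v: "v = (\<Sum>(x, y)\<leftarrow>xs. alg_tensor_of x y)"
      using alg_tensor_list[of v] by blast
    show ?thesis unfolding v of_alg_tensor_sum_list
      by (induction xs) (auto simp: cblinfun_apply_add assms)
  qed
  have "(\<lambda>n. cblinfun_apply R (of_alg_tensor (X n))) \<longlonglongrightarrow> cblinfun_apply R u"
    for R :: "('a, 'b) proj_tensor \<Rightarrow>\<^sub>C\<^sub>L 'c"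
    unfolding X(2)
    by (rule bounded_linear.tendsto[OF bounded_linear_cblinfun_apply of_alg_tensor_LIMSEQ[OF X(1)]])
  from this[of S] this[of T] show "cblinfun_apply S u = cblinfun_apply T u"
    unfolding eq by (rule LIMSEQ_unique)
qed

definition free_lift ::
    "('a \<Rightarrow> 'b \<Rightarrow> 'c::complex_vector) \<Rightarrow> (('a \<times> 'b) \<Rightarrow>\<^sub>0 complex) \<Rightarrow> 'c"
  where "free_lift \<phi> u =
    (\<Sum>k\<in>Poly_Mapping.keys u. Poly_Mapping.lookup u k *\<^sub>C \<phi> (fst k) (snd k))"

lemma free_lift_superset:
  "finite K \<Longrightarrow> Poly_Mapping.keys u \<subseteq> K \<Longrightarrow>
    free_lift \<phi> u = (\<Sum>k\<in>K. Poly_Mapping.lookup u k *\<^sub>C \<phi> (fst k) (snd k))"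
  unfolding free_lift_def by (rule sum.mono_neutral_left) (auto simp: in_keys_iff)

lemma free_lift_add: "free_lift \<phi> (u + v) = free_lift \<phi> u + free_lift \<phi> v"
proof -
  let ?K = "Poly_Mapping.keys u \<union> Poly_Mapping.keys v"
  have "finite ?K" "Poly_Mapping.keys (u + v) \<subseteq> ?K" by (auto simp: in_keys_iff lookup_add)
  then show ?thesis
    by (simp add: free_lift_superset[of ?K] lookup_add scaleC_add_left sum.distrib)
qed

lemma free_lift_scale: "free_lift \<phi> (free_scale c u) = c *\<^sub>C free_lift \<phi> u"
proof -
  have "Poly_Mapping.keys (free_scale c u) \<subseteq> Poly_Mapping.keys u" by (auto simp: in_keys_iff)
  then show ?thesis
    by (simp add: free_lift_superset[of "Poly_Mapping.keys u"] scaleC_sum_right scaleC_scaleC)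
qed

lemma free_lift_diff: "free_lift \<phi> (u - v) = free_lift \<phi> u - free_lift \<phi> v"
  using free_lift_add[of \<phi> "u - v" v] by simp

lemma free_lift_single: "free_lift \<phi> (Poly_Mapping.single (x, y) 1) = \<phi> x y"
  by (simp add: free_lift_def scaleC_one)

lemma free_lift_relations:
  assumes "bounded_cbilinear \<phi>" "u \<in> tensor_relations"
  shows "free_lift \<phi> u = 0"
proof -
  interpret bounded_bilinear \<phi> using assms(1) by (simp add: bounded_cbilinear_def)
  note hom = assms(1)[unfolded bounded_cbilinear_def]
  show ?thesis using assms(2)
  proof induction
    case rel_zero
    show ?case by (simp add: free_lift_def)
  qed (simp_all add: free_lift_add free_lift_diff free_lift_scale free_lift_single add_left add_right hom)
qed

definition alg_lift ::
    "('a::complex_vector \<Rightarrow> 'b::complex_vector \<Rightarrow> 'c::complex_vector) \<Rightarrow> ('a, 'b) alg_tensor \<Rightarrow> 'c"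
  where "alg_lift \<phi> u = free_lift \<phi> (rep_alg_tensor u)"

lemma alg_lift_abs:
  assumes "bounded_cbilinear \<phi>"
  shows "alg_lift \<phi> (abs_alg_tensor u) = free_lift \<phi> u"
proof -
  have "tensor_eq (rep_alg_tensor (abs_alg_tensor u)) u"
    by (rule Quotient3_rep_abs[OF Quotient3_alg_tensor]) (simp add: tensor_eq_def rel_zero)
  then have "free_lift \<phi> (rep_alg_tensor (abs_alg_tensor u) - u) = 0"
    unfolding tensor_eq_def by (rule free_lift_relations[OF assms])
  then show ?thesis by (simp add: alg_lift_def free_lift_diff)
qed

lemma alg_lift_simps:
  assumes "bounded_cbilinear \<phi>"
  shows "alg_lift \<phi> (u + v) = alg_lift \<phi> u + alg_lift \<phi> v"
    and "alg_lift \<phi> (c *\<^sub>C u) = c *\<^sub>C alg_lift \<phi> u"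
    and "alg_lift \<phi> (alg_tensor_of x y) = \<phi> x y"
proof -
  have abs: "abs_alg_tensor (rep_alg_tensor w) = w" for w :: "('a, 'b) alg_tensor"
    by (rule Quotient3_abs_rep[OF Quotient3_alg_tensor])
  have "alg_lift \<phi> (abs_alg_tensor (rep_alg_tensor u) + abs_alg_tensor (rep_alg_tensor v))
      = alg_lift \<phi> (abs_alg_tensor (rep_alg_tensor u)) + alg_lift \<phi> (abs_alg_tensor (rep_alg_tensor v))"
    by (simp only: plus_alg_tensor.abs_eq alg_lift_abs[OF assms] free_lift_add)
  then show "alg_lift \<phi> (u + v) = alg_lift \<phi> u + alg_lift \<phi> v" by (simp only: abs)
  have "alg_lift \<phi> (c *\<^sub>C abs_alg_tensor (rep_alg_tensor u))
      = c *\<^sub>C alg_lift \<phi> (abs_alg_tensor (rep_alg_tensor u))"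
    by (simp only: scaleC_alg_tensor.abs_eq alg_lift_abs[OF assms] free_lift_scale)
  then show "alg_lift \<phi> (c *\<^sub>C u) = c *\<^sub>C alg_lift \<phi> u" by (simp only: abs)
  show "alg_lift \<phi> (alg_tensor_of x y) = \<phi> x y"
    by (simp only: alg_tensor_of.abs_eq alg_lift_abs[OF assms] free_lift_single)
qed

lemma alg_lift_bound:
  assumes "bounded_cbilinear \<phi>" "0 \<le> K" "\<And>x y. norm (\<phi> x y) \<le> norm x * norm y * K"
  shows "norm (alg_lift \<phi> u) \<le> K * proj_norm u"
proof (cases "K = 0")
  case True
  obtain xs where u: "u = (\<Sum>(x, y)\<leftarrow>xs. alg_tensor_of x y)"
    using alg_tensor_list[of u] by blast
  have z: "alg_lift \<phi> 0 = 0" using alg_lift_simps(1)[OF assms(1), of 0 0] by simp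
  have "alg_lift \<phi> u = 0"
    unfolding u using assms(3) True
    by (induction xs) (auto simp: z alg_lift_simps[OF assms(1)])
  then show ?thesis using True by simp
next
  case False
  have "norm (alg_lift \<phi> u) / K \<le> proj_norm u"
  proof (rule proj_norm_greatest)
    fix xs assume u: "u = (\<Sum>(x, y)\<leftarrow>xs. alg_tensor_of x y)"
    have z: "alg_lift \<phi> 0 = 0" using alg_lift_simps(1)[OF assms(1), of 0 0] by simp
    have "norm (alg_lift \<phi> (\<Sum>(x, y)\<leftarrow>xs. alg_tensor_of x y)) \<le> K * (\<Sum>(x, y)\<leftarrow>xs. norm x * norm y)"
    proof (induction xs)
      case (Cons p xs)
      obtain x y where p: "p = (x, y)" by (cases p)
      show ?case
        using norm_triangle_ineq[of "\<phi> x y" "alg_lift \<phi> (\<Sum>(x, y)\<leftarrow>xs. alg_tensor_of x y)"]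
          Cons.IH assms(3)[of x y]
        by (simp add: p alg_lift_simps[OF assms(1)] algebra_simps)
    qed (simp add: z)
    then show "norm (alg_lift \<phi> u) / K \<le> (\<Sum>(x, y)\<leftarrow>xs. norm x * norm y)"
      using False assms(2) by (simp add: u field_simps)
  qed
  then show ?thesis using False assms(2) by (simp add: field_simps)
qed

lemma proj_lift_exists:
  fixes \<phi> :: "'a::complex_normed_vector \<Rightarrow> 'b::complex_normed_vector \<Rightarrow> 'c::{complex_normed_vector, banach}"
  assumes \<phi>: "bounded_cbilinear \<phi>"
  shows "\<exists>T. \<forall>x y. cblinfun_apply T (x \<otimes>\<^sub>p y) = \<phi> x y"
proof -
  interpret bounded_bilinear \<phi> using \<phi> by (simp add: bounded_cbilinear_def)
  obtain K where K: "0 \<le> K" "\<And>x y. norm (\<phi> x y) \<le> norm x * norm y * K"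
    using nonneg_bounded by blast
  note lift = alg_lift_simps[OF \<phi>] and bound = alg_lift_bound[OF \<phi> K]
  have diff: "alg_lift \<phi> (u - v) = alg_lift \<phi> u - alg_lift \<phi> v" for u v
    using lift(1)[of "u - v" v] by simp
  have conv: "convergent (\<lambda>n. alg_lift \<phi> (X n))" if X: "proj_Cauchy X" for X
  proof -
    have "Cauchy (\<lambda>n. alg_lift \<phi> (X n))"
    proof (rule CauchyI)
      fix e :: real assume "0 < e"
      then have "0 < e / (K + 1)" using K(1) by simp
      then obtain N where N: "\<And>m n. m \<ge> N \<Longrightarrow> n \<ge> N \<Longrightarrow> proj_norm (X m - X n) < e / (K + 1)"
        using X unfolding proj_Cauchy_def by meson
      have "norm (alg_lift \<phi> (X m) - alg_lift \<phi> (X n)) < e" if "m \<ge> N" "n \<ge> N" for m n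
      proof -
        have "norm (alg_lift \<phi> (X m) - alg_lift \<phi> (X n)) \<le> K * proj_norm (X m - X n)"
          using bound[of "X m - X n"] by (simp add: diff)
        also have "\<dots> \<le> K * (e / (K + 1))"
          by (intro mult_left_mono less_imp_le N that K(1))
        also have "\<dots> < e" using K(1) \<open>0 < e\<close> by (simp add: field_simps)
        finally show ?thesis .
      qed
      then show "\<exists>M. \<forall>m\<ge>M. \<forall>n\<ge>M. norm (alg_lift \<phi> (X m) - alg_lift \<phi> (X n)) < e" by blast
    qed
    then show ?thesis by (simp add: Cauchy_convergent_iff)
  qed
  define r where "r u = (SOME X. proj_Cauchy X \<and> u = abs_proj_tensor X)" for u :: "('a, 'b) proj_tensor"
  have r: "proj_Cauchy (r u)" "u = abs_proj_tensor (r u)" for u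
  proof -
    have "\<exists>X. proj_Cauchy X \<and> u = abs_proj_tensor X" by (rule proj_tensor_exhaust[of u]) blast
    from someI_ex[OF this] show "proj_Cauchy (r u)" "u = abs_proj_tensor (r u)"
      by (auto simp only: r_def)
  qed
  define T where "T u = lim (\<lambda>n. alg_lift \<phi> (r u n))" for u
  have T: "(\<lambda>n. alg_lift \<phi> (X n)) \<longlonglongrightarrow> T (abs_proj_tensor X)" if X: "proj_Cauchy X" for X
  proof -
    let ?Y = "r (abs_proj_tensor X)"
    have 1: "(\<lambda>n. alg_lift \<phi> (?Y n)) \<longlonglongrightarrow> T (abs_proj_tensor X)"
      unfolding T_def using conv[OF r(1)] by (simp add: convergent_LIMSEQ_iff)
    have 2: "(\<lambda>n. alg_lift \<phi> (X n) - alg_lift \<phi> (?Y n)) \<longlonglongrightarrow> 0"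
    proof (rule tendsto_norm_zero_cancel, rule tendsto_sandwich[OF _ _ tendsto_const])
      show "\<forall>\<^sub>F n in sequentially. norm (alg_lift \<phi> (X n) - alg_lift \<phi> (?Y n)) \<le> K * proj_norm (X n - ?Y n)"
        using bound by (simp add: diff[symmetric])
      have "(\<lambda>n. proj_norm (X n - ?Y n)) \<longlonglongrightarrow> 0"
        using abs_proj_tensor_eq_iff[OF X r(1)] r(2) by blast
      then show "(\<lambda>n. K * proj_norm (X n - ?Y n)) \<longlonglongrightarrow> 0"
        by (rule tendsto_mult_right_zero)
    qed auto
    show ?thesis using tendsto_add[OF 2 1] by simp
  qed
  have T_add: "T (u + v) = T u + T v" for u v
  proof -
    obtain X where X: "proj_Cauchy X" "u = abs_proj_tensor X" by (rule proj_tensor_exhaust)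
    obtain Y where Y: "proj_Cauchy Y" "v = abs_proj_tensor Y" by (rule proj_tensor_exhaust)
    show ?thesis
      unfolding X(2) Y(2) plus_abs[OF X(1) Y(1)]
      by (rule LIMSEQ_unique[OF T[OF proj_Cauchy_add[OF X(1) Y(1)], unfolded lift]
            tendsto_add[OF T[OF X(1)] T[OF Y(1)]]])
  qed
  have T_scale: "T (c *\<^sub>C u) = c *\<^sub>C T u" for c u
  proof -
    obtain X where X: "proj_Cauchy X" "u = abs_proj_tensor X" by (rule proj_tensor_exhaust)
    show ?thesis
      unfolding X(2) scaleC_abs[OF X(1)]
      by (rule LIMSEQ_unique[OF T[OF proj_Cauchy_scaleC[OF X(1)], unfolded lift]
            bounded_linear.tendsto[OF bounded_linear_scaleC T[OF X(1)]]])
  qed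
  have T_bound: "norm (T u) \<le> norm u * K" for u
  proof -
    obtain X where X: "proj_Cauchy X" "u = abs_proj_tensor X" by (rule proj_tensor_exhaust)
    have "norm (T u) \<le> K * norm u"
      unfolding X(2) norm_abs[OF X(1)]
      by (rule LIMSEQ_le[OF tendsto_norm[OF T[OF X(1)]] tendsto_mult_left[OF proj_norm_lim[OF X(1)]]])
         (auto simp: bound)
    then show ?thesis by (simp add: mult.commute)
  qed
  have "bounded_linear T"
    by (rule bounded_linear_intro[where K=K]) (auto simp: T_add T_scale T_bound scaleR_scaleC)
  then have "cblinfun_apply (CBlinfun T) = T"
    by (rule cblinfun_apply_CBlinfun) (rule T_scale)
  moreover have "T (x \<otimes>\<^sub>p y) = \<phi> x y" for x y
    using T[OF proj_Cauchy_const[of "alg_tensor_of x y"]]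
    by (simp add: tensor_def of_alg_tensor_def lift LIMSEQ_const_iff)
  ultimately show ?thesis by (intro exI[of _ "CBlinfun T"]) simp
qed

lemma proj_lift_tensor:
  fixes \<phi> :: "'a::complex_normed_vector \<Rightarrow> 'b::complex_normed_vector \<Rightarrow> 'c::{complex_normed_vector, banach}"
  assumes "bounded_cbilinear \<phi>"
  shows "cblinfun_apply (proj_lift \<phi>) (x \<otimes>\<^sub>p y) = \<phi> x y"
proof -
  have "\<exists>!T. \<forall>x y. cblinfun_apply T (x \<otimes>\<^sub>p y) = \<phi> x y"
    using proj_lift_exists[OF assms] by (auto intro!: proj_tensor_cblinfun_eqI)
  from theI'[OF this] show ?thesis by (simp add: proj_lift_def)
qed


section \<open>The bimodules \<open>A\<close>, \<open>A \<otimes>\<^sub>p A\<close> and their biduals\<close>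

definition mult_left :: "'a::complex_normed_algebra \<Rightarrow> 'a \<Rightarrow>\<^sub>C\<^sub>L 'a"
  where "mult_left a = CBlinfun (\<lambda>x. a * x)"

definition mult_right :: "'a::complex_normed_algebra \<Rightarrow> 'a \<Rightarrow>\<^sub>C\<^sub>L 'a"
  where "mult_right a = CBlinfun (\<lambda>x. x * a)"

definition tensor_left ::
    "'a::{complex_normed_algebra, banach} \<Rightarrow> ('a, 'a) proj_tensor \<Rightarrow>\<^sub>C\<^sub>L ('a, 'a) proj_tensor"
  where "tensor_left a = proj_lift (\<lambda>b c. (a * b) \<otimes>\<^sub>p c)"

definition tensor_right ::
    "'a::{complex_normed_algebra, banach} \<Rightarrow> ('a, 'a) proj_tensor \<Rightarrow>\<^sub>C\<^sub>L ('a, 'a) proj_tensor"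
  where "tensor_right a = proj_lift (\<lambda>b c. b \<otimes>\<^sub>p (c * a))"

definition product_map :: "('a::{complex_normed_algebra, banach}, 'a) proj_tensor \<Rightarrow>\<^sub>C\<^sub>L 'a"
  where "product_map = proj_lift (\<lambda>b c. b * c)"

lemma mult_left_apply: "cblinfun_apply (mult_left a) x = a * x"
  unfolding mult_left_def
  by (subst cblinfun_apply_CBlinfun) (auto simp: bounded_linear_mult_right mult_scaleC_right)

lemma mult_right_apply: "cblinfun_apply (mult_right a) x = x * a"
  unfolding mult_right_def
  by (subst cblinfun_apply_CBlinfun) (auto simp: bounded_linear_mult_left mult_scaleC_left)

lemma bounded_cbilinear_tensor: "bounded_cbilinear (\<otimes>\<^sub>p)"
proof -
  have "bounded_bilinear (\<otimes>\<^sub>p)"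
    by standard (auto simp: tensor_simps scaleR_scaleC intro!: exI[of _ 1] norm_tensor_le)
  then show ?thesis by (simp add: bounded_cbilinear_def tensor_simps)
qed

lemma tensor_left_tensor: "cblinfun_apply (tensor_left a) (b \<otimes>\<^sub>p c) = (a * b) \<otimes>\<^sub>p c"
  unfolding tensor_left_def
proof (rule proj_lift_tensor)
  have "bounded_bilinear (\<lambda>b c. (a * b) \<otimes>\<^sub>p c)"
    using bounded_bilinear.comp1[OF _ bounded_linear_mult_right] bounded_cbilinear_tensor
    unfolding bounded_cbilinear_def by blast
  then show "bounded_cbilinear (\<lambda>b c. (a * b) \<otimes>\<^sub>p c)"
    by (simp add: bounded_cbilinear_def mult_scaleC_right tensor_simps)
qed

lemma tensor_right_tensor: "cblinfun_apply (tensor_right a) (b \<otimes>\<^sub>p c) = b \<otimes>\<^sub>p (c * a)"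
  unfolding tensor_right_def
proof (rule proj_lift_tensor)
  have "bounded_bilinear (\<lambda>b c. b \<otimes>\<^sub>p (c * a))"
    using bounded_bilinear.comp[OF _ bounded_linear_ident bounded_linear_mult_left] bounded_cbilinear_tensor
    unfolding bounded_cbilinear_def by blast
  then show "bounded_cbilinear (\<lambda>b c. b \<otimes>\<^sub>p (c * a))"
    by (simp add: bounded_cbilinear_def mult_scaleC_left tensor_simps)
qed

lemma product_map_tensor: "cblinfun_apply product_map (b \<otimes>\<^sub>p c) = b * c"
  unfolding product_map_def
  by (rule proj_lift_tensor)
     (simp add: bounded_cbilinear_def bounded_bilinear_mult mult_scaleC_left mult_scaleC_right)

text \<open>On the dual of a bimodule \<open>(a \<cdot> f)(x) = f(x \<cdot> a)\<close> and \<open>(f \<cdot> a)(x) = f(a \<cdot> x)\<close>, so left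
  multiplication by \<open>a\<close> on the dual is the adjoint of right multiplication by \<open>a\<close> and vice versa.
  On the bidual, multiplication by \<open>a\<close> from either side is therefore the biadjoint of
  multiplication by \<open>a\<close> from the same side.\<close>

definition bidual_right :: "'a bidual \<Rightarrow> 'a::{complex_normed_algebra, banach} \<Rightarrow> 'a bidual"
  where "bidual_right m a = cblinfun_apply (biadjoint (mult_right a)) m"

definition tensor_bidual_left ::
    "'a::{complex_normed_algebra, banach} \<Rightarrow> ('a, 'a) proj_tensor bidual \<Rightarrow> ('a, 'a) proj_tensor bidual"
  where "tensor_bidual_left a M = cblinfun_apply (biadjoint (tensor_left a)) M"

definition tensor_bidual_right ::
    "('a, 'a) proj_tensor bidual \<Rightarrow> 'a::{complex_normed_algebra, banach} \<Rightarrow> ('a, 'a) proj_tensor bidual"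
  where "tensor_bidual_right M a = cblinfun_apply (biadjoint (tensor_right a)) M"

definition product_bidual ::
    "('a::{complex_normed_algebra, banach}, 'a) proj_tensor bidual \<Rightarrow> 'a bidual"
  where "product_bidual M = cblinfun_apply (biadjoint product_map) M"


section \<open>Amenability and Johnson pseudo-contractibility\<close>

definition amenable :: "'a::{complex_normed_algebra, banach} itself \<Rightarrow> bool"
  where "amenable _ \<longleftrightarrow>
    (\<exists>M :: ('a, 'a) proj_tensor bidual. \<forall>a.
       tensor_bidual_left a M = tensor_bidual_right M a \<and>
       bidual_right (product_bidual M) a = canonical_embedding a)"

definition directed_set :: "'i set \<Rightarrow> ('i \<Rightarrow> 'i \<Rightarrow> bool) \<Rightarrow> bool"
  where "directed_set I le \<longleftrightarrow> I \<noteq> {} \<and>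
    (\<forall>i\<in>I. le i i) \<and>
    (\<forall>i\<in>I. \<forall>j\<in>I. \<forall>k\<in>I. le i j \<longrightarrow> le j k \<longrightarrow> le i k) \<and>
    (\<forall>i\<in>I. \<forall>j\<in>I. \<exists>k\<in>I. le i k \<and> le j k)"

definition net_tendsto ::
    "'i set \<Rightarrow> ('i \<Rightarrow> 'i \<Rightarrow> bool) \<Rightarrow> ('i \<Rightarrow> 'v::real_normed_vector) \<Rightarrow> 'v \<Rightarrow> bool"
  where "net_tendsto I le x l \<longleftrightarrow>
    (\<forall>e>0. \<exists>i\<in>I. \<forall>j\<in>I. le i j \<longrightarrow> norm (x j - l) < e)"

text \<open>The second argument is the type in which the index set of the net lives. A definition cannot
  quantify over types, so a statement about all nets has to leave this type variable free.\<close>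

definition johnson_pseudo_contractible ::
    "'a::{complex_normed_algebra, banach} itself \<Rightarrow> 'i itself \<Rightarrow> bool"
  where "johnson_pseudo_contractible _ _ \<longleftrightarrow>
    (\<exists>(I :: 'i set) le (m :: 'i \<Rightarrow> ('a, 'a) proj_tensor bidual).
       directed_set I le \<and>
       (\<forall>a. \<forall>i\<in>I. tensor_bidual_left a (m i) = tensor_bidual_right (m i) a) \<and>
       (\<forall>a. net_tendsto I le
         (\<lambda>i. bidual_right (product_bidual (m i)) a - canonical_embedding a) 0))"

end

(* Let e be the identity. Some m in the given net satisfies ||n - e|| < 1 for n = \<pi>**(m), and n
   commutes with A. Hence (T f)(a) = n(a.f) defines a bimodule map T on A* with
   ||T f - f|| <= ||n - e|| ||f||, so T is invertible and R = T^-1 is again a bimodule map. For a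
   functional \<phi> on the projective tensor square let (S \<phi>)(x (x) y) = (R (\<phi>(x (x) -)))(y). Then S is
   a bimodule map with S \<circ> \<pi>* = \<pi>* \<circ> R, and M = m \<circ> S is a virtual diagonal, since
   M(\<pi>* f) = n(R f) = (T (R f))(e) = f(e). The operator R plays the role of multiplication by the
   Arens inverse of n, so Arens products are not needed. *)
theory Submission
  imports Defs
begin

section \<open>Bounded complex-linear maps\<close>

lemma cblinfun_apply_diff: "cblinfun_apply T (u - v) = cblinfun_apply T u - cblinfun_apply T v"
  by (rule linear_diff[OF bounded_linear.linear[OF bounded_linear_cblinfun_apply]])

lemma cblinfun_apply_diff_left: "cblinfun_apply (f - g) x = cblinfun_apply f x - cblinfun_apply g x"
  by transfer (rule blinfun.diff_left)

text \<open>The existence form suits maps known only pointwise through a choice, such as the inverse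
  \<open>r\<close> or the functional \<open>t f\<close> below.\<close>

lemma cblinfun_exists:
  fixes f :: "'a::complex_normed_vector \<Rightarrow> 'b::complex_normed_vector"
  assumes add: "\<And>x y. f (x + y) = f x + f y"
    and scale: "\<And>c x. f (c *\<^sub>C x) = c *\<^sub>C f x"
    and bound: "\<And>x. norm (f x) \<le> K * norm x"
  shows "\<exists>F. \<forall>x. cblinfun_apply F x = f x"
proof -
  have "bounded_linear f"
    by (rule bounded_linear_intro[where K=K])
       (use bound in \<open>auto simp: add scale scaleR_scaleC mult.commute\<close>)
  from cblinfun_apply_CBlinfun[OF this scale] show ?thesis
    by (intro exI[of _ "CBlinfun f"]) simp
qed

text \<open>Completeness of the dual is what allows an operator on it to be inverted by a fixed
  point argument. The limit is taken among the bounded real-linear maps; being also a pointwise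
  limit, it stays complex-linear.\<close>

instance cblinfun :: (complex_normed_vector, "{complex_normed_vector, banach}") banach
proof
  fix X :: "nat \<Rightarrow> 'a \<Rightarrow>\<^sub>C\<^sub>L 'b"
  assume X: "Cauchy X"
  have dist_eq: "dist (blinfun_of_cblinfun f) (blinfun_of_cblinfun g) = dist f g"
    for f g :: "'a \<Rightarrow>\<^sub>C\<^sub>L 'b"
    by (simp add: dist_norm norm_cblinfun.rep_eq minus_cblinfun.rep_eq)
  have "Cauchy (\<lambda>n. blinfun_of_cblinfun (X n))"
    using X by (simp add: Cauchy_def dist_eq)
  then obtain L where L: "(\<lambda>n. blinfun_of_cblinfun (X n)) \<longlonglongrightarrow> L"
    by (auto simp: Cauchy_convergent_iff convergent_def)
  have lim: "(\<lambda>n. cblinfun_apply (X n) x) \<longlonglongrightarrow> blinfun_apply L x" for x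
    unfolding cblinfun_apply.rep_eq by (intro tendsto_intros L)
  have "blinfun_apply L (c *\<^sub>C x) = c *\<^sub>C blinfun_apply L x" for c x
    by (rule LIMSEQ_unique[OF lim[of "c *\<^sub>C x", unfolded cblinfun_apply_scaleC]
          bounded_linear.tendsto[OF bounded_linear_scaleC lim]])
  then have "blinfun_of_cblinfun (Abs_cblinfun L) = L"
    by (subst Abs_cblinfun_inverse) auto
  with L have "X \<longlonglongrightarrow> Abs_cblinfun L"
    unfolding lim_sequentially by (metis dist_eq)
  then show "convergent X" by (rule convergentI)
qed

text \<open>The estimate bounds \<open>T\<close> below by \<open>1 - c\<close>, which gives both
  injectivity and the norm bound of the inverse; surjectivity comes from the contraction principle
  rather than from a Neumann series.\<close>

lemma near_identity_inverse:
  fixes T :: "'a::{complex_normed_vector, banach} \<Rightarrow>\<^sub>C\<^sub>L 'a"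
  assumes c: "0 \<le> c" "c < 1"
    and near: "\<And>x. norm (cblinfun_apply T x - x) \<le> c * norm x"
  obtains R where "\<And>x. cblinfun_apply T (cblinfun_apply R x) = x"
    and "\<And>x. cblinfun_apply R (cblinfun_apply T x) = x"
proof -
  have lower: "norm x \<le> inverse (1 - c) * norm (cblinfun_apply T x)" for x
  proof -
    have "norm x \<le> norm (cblinfun_apply T x - x) + norm (cblinfun_apply T x)"
      using norm_triangle_ineq4[of "cblinfun_apply T x" "cblinfun_apply T x - x"] by simp
    with near[of x] have "(1 - c) * norm x \<le> norm (cblinfun_apply T x)"
      by (simp add: algebra_simps)
    with c show ?thesis by (simp add: field_simps)
  qed
  have inj: "x = y" if "cblinfun_apply T x = cblinfun_apply T y" for x y
    using lower[of "x - y"] that by (simp add: cblinfun_apply_diff)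
  have "\<exists>x. cblinfun_apply T x = y" for y
  proof -
    \<comment> \<open>The fixed points of \<open>?g\<close> are exactly the solutions of
      \<open>T x = y\<close>, and \<open>near\<close> makes \<open>?g\<close> a contraction with
      constant \<open>c\<close>.\<close>
    let ?g = "\<lambda>x. y + x - cblinfun_apply T x"
    have "\<exists>!x\<in>UNIV. ?g x = x"
    proof (rule Banach_fix[OF _ _ c])
      fix x x'
      have "?g x - ?g x' = - (cblinfun_apply T (x - x') - (x - x'))"
        by (simp add: cblinfun_apply_diff)
      then show "dist (?g x) (?g x') \<le> c * dist x x'"
        using near[of "x - x'"] unfolding dist_norm by (simp only: norm_minus_cancel)
    qed (auto simp: complete_UNIV)
    then show ?thesis by (auto simp: algebra_simps)
  qed
  then obtain r where r: "\<And>y. cblinfun_apply T (r y) = y" by metis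
  have "\<exists>R. \<forall>y. cblinfun_apply R y = r y"
  proof (rule cblinfun_exists[of r])
    show "r (x + y) = r x + r y" for x y
      by (rule inj) (simp add: r cblinfun_apply_add)
    show "r (k *\<^sub>C x) = k *\<^sub>C r x" for k x
      by (rule inj) (simp add: r cblinfun_apply_scaleC)
    show "norm (r x) \<le> inverse (1 - c) * norm x" for x
      using lower[of "r x"] by (simp add: r)
  qed
  then obtain R where R: "\<And>y. cblinfun_apply R y = r y" by blast
  show ?thesis
    by (rule that[of R]) (auto simp: R r intro: inj)
qed

section \<open>Functionals on a projective tensor product\<close>

text \<open>This is the operator from the first factor into the dual of the second that corresponds
  to \<open>\<phi>\<close> when functionals on the projective tensor product are read as such
  operators.\<close>

definition slice ::
    "('a::complex_normed_vector, 'b::complex_normed_vector) proj_tensor dual \<Rightarrow> 'a \<Rightarrow> 'b dual"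
  where "slice \<phi> x = CBlinfun (\<lambda>y. cblinfun_apply \<phi> (x \<otimes>\<^sub>p y))"

lemma norm_apply_tensor_le: "norm (cblinfun_apply \<phi> (x \<otimes>\<^sub>p y)) \<le> norm \<phi> * norm x * norm y"
  using norm_cblinfun[of \<phi> "x \<otimes>\<^sub>p y"] mult_left_mono[OF norm_tensor_le[of x y], of "norm \<phi>"]
  by (simp add: mult.assoc)

lemma slice_apply: "cblinfun_apply (slice \<phi> x) y = cblinfun_apply \<phi> (x \<otimes>\<^sub>p y)"
proof -
  have "\<exists>F. \<forall>y. cblinfun_apply F y = cblinfun_apply \<phi> (x \<otimes>\<^sub>p y)"
    by (rule cblinfun_exists[of "\<lambda>y. cblinfun_apply \<phi> (x \<otimes>\<^sub>p y)" "norm \<phi> * norm x"])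
       (auto simp: tensor_simps cblinfun_apply_add cblinfun_apply_scaleC norm_apply_tensor_le)
  then have "bounded_linear (\<lambda>y. cblinfun_apply \<phi> (x \<otimes>\<^sub>p y))"
    by (metis (no_types, lifting) ext bounded_linear_cblinfun_apply)
  then show ?thesis
    unfolding slice_def
    by (subst cblinfun_apply_CBlinfun) (auto simp: tensor_simps cblinfun_apply_scaleC)
qed

lemma slice_simps:
  "slice (\<phi> + \<psi>) x = slice \<phi> x + slice \<psi> x"
  "slice (c *\<^sub>C \<phi>) x = c *\<^sub>C slice \<phi> x"
  "slice \<phi> (x + x') = slice \<phi> x + slice \<phi> x'"
  "slice \<phi> (c *\<^sub>C x) = c *\<^sub>C slice \<phi> x"
  by (auto intro!: cblinfun_eqI simp: slice_apply cblinfun_apply_add_left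
      cblinfun_apply_scaleC_left tensor_simps cblinfun_apply_add cblinfun_apply_scaleC)

lemma norm_slice_le: "norm (slice \<phi> x) \<le> norm \<phi> * norm x"
  by (rule norm_cblinfun_bound) (auto simp: slice_apply norm_apply_tensor_le)

text \<open>On algebraic tensors the lift is \<open>alg_lift\<close>, where the bound is known, and
  density carries it over to the completion. It serves to bound an operator whose values are
  lifts.\<close>

lemma norm_proj_lift_le:
  fixes \<phi> :: "'a::complex_normed_vector \<Rightarrow> 'b::complex_normed_vector \<Rightarrow> 'c::{complex_normed_vector, banach}"
  assumes \<phi>: "bounded_cbilinear \<phi>" and K: "0 \<le> K" "\<And>x y. norm (\<phi> x y) \<le> norm x * norm y * K"
  shows "norm (proj_lift \<phi>) \<le> K"
proof (rule norm_cblinfun_bound[OF K(1)])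
  fix u :: "('a, 'b) proj_tensor"
  obtain X where X: "proj_Cauchy X" "u = abs_proj_tensor X" by (rule proj_tensor_exhaust)
  have alg: "cblinfun_apply (proj_lift \<phi>) (of_alg_tensor v) = alg_lift \<phi> v" for v
  proof -
    obtain xs where v: "v = (\<Sum>(x, y)\<leftarrow>xs. alg_tensor_of x y)"
      using alg_tensor_list[of v] by blast
    have z: "alg_lift \<phi> 0 = 0" using alg_lift_simps(1)[OF \<phi>, of 0 0] by simp
    show ?thesis
      unfolding v of_alg_tensor_sum_list
      by (induction xs)
         (auto simp: z alg_lift_simps[OF \<phi>] cblinfun_apply_add proj_lift_tensor[OF \<phi>])
  qed
  have u: "(\<lambda>n. of_alg_tensor (X n)) \<longlonglongrightarrow> u"
    unfolding X(2) by (rule of_alg_tensor_LIMSEQ[OF X(1)])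
  show "norm (cblinfun_apply (proj_lift \<phi>) u) \<le> K * norm u"
    by (rule LIMSEQ_le[OF tendsto_norm[OF bounded_linear.tendsto[OF bounded_linear_cblinfun_apply u]]
          tendsto_mult_left[OF tendsto_norm[OF u]]])
       (simp add: alg norm_of_alg_tensor alg_lift_bound[OF \<phi> K])
qed

text \<open>With functionals read as operators into the dual of the second factor, \<open>S\<close>
  is composition with \<open>R\<close>, hence bounded by \<open>norm R\<close>.\<close>

lemma slicewise_operator:
  fixes R :: "'b::complex_normed_vector dual \<Rightarrow>\<^sub>C\<^sub>L 'b dual"
  obtains S :: "('a::complex_normed_vector, 'b) proj_tensor dual \<Rightarrow>\<^sub>C\<^sub>L ('a, 'b) proj_tensor dual"
  where "\<And>\<phi> x. slice (cblinfun_apply S \<phi>) x = cblinfun_apply R (slice \<phi> x)"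
proof -
  define b where "b \<phi> x y = cblinfun_apply (cblinfun_apply R (slice \<phi> x)) y"
    for \<phi> :: "('a, 'b) proj_tensor dual" and x y
  have bound: "norm (b \<phi> x y) \<le> norm x * norm y * (norm R * norm \<phi>)" for \<phi> x y
  proof -
    have "norm (b \<phi> x y) \<le> norm (cblinfun_apply R (slice \<phi> x)) * norm y"
      unfolding b_def by (rule norm_cblinfun)
    also have "\<dots> \<le> norm R * norm (slice \<phi> x) * norm y"
      by (intro mult_right_mono norm_cblinfun) auto
    also have "\<dots> \<le> norm R * (norm \<phi> * norm x) * norm y"
      by (intro mult_right_mono mult_left_mono norm_slice_le) auto
    finally show ?thesis by (simp add: ac_simps)
  qed
  have simps: "b \<phi> (x + x') y = b \<phi> x y + b \<phi> x' y" "b \<phi> x (y + y') = b \<phi> x y + b \<phi> x y'"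
    "b \<phi> (c *\<^sub>C x) y = c *\<^sub>C b \<phi> x y" "b \<phi> x (c *\<^sub>C y) = c *\<^sub>C b \<phi> x y" for \<phi> x x' y y' c
    by (simp_all add: b_def slice_simps cblinfun_apply_add cblinfun_apply_scaleC
        cblinfun_apply_add_left cblinfun_apply_scaleC_left)
  have bil: "bounded_cbilinear (b \<phi>)" for \<phi>
  proof -
    have "bounded_bilinear (b \<phi>)"
      by standard (auto simp: simps scaleR_scaleC intro: bound)
    then show ?thesis by (simp add: bounded_cbilinear_def simps)
  qed
  note lift = proj_lift_tensor[OF bil]
  have "\<exists>S. \<forall>\<phi>. cblinfun_apply S \<phi> = proj_lift (b \<phi>)"
  proof (rule cblinfun_exists[of "\<lambda>\<phi>. proj_lift (b \<phi>)" "norm R"])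
    show "norm (proj_lift (b \<phi>)) \<le> norm R * norm \<phi>" for \<phi>
      by (rule norm_proj_lift_le[OF bil]) (auto intro: bound)
  qed (auto intro!: proj_tensor_cblinfun_eqI simp: lift cblinfun_apply_add_left
      cblinfun_apply_scaleC_left b_def slice_simps cblinfun_apply_add cblinfun_apply_scaleC)
  then obtain S where S: "\<And>\<phi>. cblinfun_apply S \<phi> = proj_lift (b \<phi>)" by blast
  show ?thesis
    by (rule that[of S]) (auto intro!: cblinfun_eqI simp: slice_apply S lift b_def)
qed

lemma proj_tensor_dual_eqI: "\<phi> = \<psi>" if "\<And>x. slice \<phi> x = slice \<psi> x"
  by (rule proj_tensor_cblinfun_eqI) (metis slice_apply that)


section \<open>Bimodule operations on duals\<close>

definition dual_left :: "'a::complex_normed_algebra \<Rightarrow> 'a dual \<Rightarrow> 'a dual"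
  where "dual_left a f = cblinfun_apply (adjoint_map (mult_right a)) f"

definition dual_right :: "'a::complex_normed_algebra dual \<Rightarrow> 'a \<Rightarrow> 'a dual"
  where "dual_right f a = cblinfun_apply (adjoint_map (mult_left a)) f"

lemma dual_left_apply: "cblinfun_apply (dual_left a f) x = cblinfun_apply f (x * a)"
  by (simp add: dual_left_def adjoint_map_apply mult_right_apply)

lemma dual_left_unit: "dual_left e f = f" if "\<And>x. x * e = x"
  by (rule cblinfun_eqI) (simp add: dual_left_apply that)

lemma dual_right_apply: "cblinfun_apply (dual_right f a) x = cblinfun_apply f (a * x)"
  by (simp add: dual_right_def adjoint_map_apply mult_left_apply)

lemma dual_left_simps:
  "dual_left a (f + g) = dual_left a f + dual_left a g"
  "dual_left (a + b) f = dual_left a f + dual_left b f"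
  "dual_left a (c *\<^sub>C f) = c *\<^sub>C dual_left a f"
  "dual_left (c *\<^sub>C a) f = c *\<^sub>C dual_left a f"
  by (auto intro!: cblinfun_eqI simp: dual_left_apply cblinfun_apply_add_left distrib_left
      cblinfun_apply_scaleC_left cblinfun_apply_add cblinfun_apply_scaleC mult_scaleC_right)

lemma norm_dual_left_le: "norm (dual_left a f) \<le> norm f * norm a"
proof (rule norm_cblinfun_bound)
  fix x
  have "norm (cblinfun_apply f (x * a)) \<le> norm f * norm (x * a)"
    by (rule norm_cblinfun)
  also have "\<dots> \<le> norm f * (norm x * norm a)"
    by (intro mult_left_mono norm_mult_ineq) auto
  finally show "norm (cblinfun_apply (dual_left a f) x) \<le> norm f * norm a * norm x"
    by (simp add: dual_left_apply ac_simps)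
qed simp

text \<open>The right action touches the second factor and so acts on the values of the slice map,
  whereas the left action only moves its argument. A slicewise operator therefore respects the
  latter automatically and the former as soon as it commutes with \<open>dual_left\<close>.\<close>

lemma slice_tensor_right:
  "slice (cblinfun_apply (adjoint_map (tensor_right a)) \<phi>) x = dual_left a (slice \<phi> x)"
  by (rule cblinfun_eqI)
     (simp add: slice_apply adjoint_map_apply tensor_right_tensor dual_left_apply)

lemma slice_tensor_left:
  "slice (cblinfun_apply (adjoint_map (tensor_left a)) \<phi>) x = slice \<phi> (a * x)"
  by (rule cblinfun_eqI) (simp add: slice_apply adjoint_map_apply tensor_left_tensor)

lemma slice_product_map:
  "slice (cblinfun_apply (adjoint_map product_map) f) x = dual_right f x"
  by (rule cblinfun_eqI)
     (simp add: slice_apply adjoint_map_apply product_map_tensor dual_right_apply)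

text \<open>Associativity makes the adjoint of \<open>product_map\<close> a bimodule map; this
  transfers commutation with the algebra from \<open>m\<close> to its image in the bidual.\<close>

lemma product_map_dual_left:
  "cblinfun_apply (adjoint_map product_map) (dual_left a f) =
    cblinfun_apply (adjoint_map (tensor_right a)) (cblinfun_apply (adjoint_map product_map) f)"
  by (rule proj_tensor_cblinfun_eqI)
     (simp add: adjoint_map_apply product_map_tensor tensor_right_tensor dual_left_apply mult.assoc)

lemma product_map_dual_right:
  "cblinfun_apply (adjoint_map product_map) (dual_right f a) =
    cblinfun_apply (adjoint_map (tensor_left a)) (cblinfun_apply (adjoint_map product_map) f)"
  by (rule proj_tensor_cblinfun_eqI)
     (simp add: adjoint_map_apply product_map_tensor tensor_left_tensor dual_right_apply mult.assoc)

lemma bidual_right_apply: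
  "cblinfun_apply (bidual_right n a) f = cblinfun_apply n (dual_left a f)"
  by (simp add: bidual_right_def biadjoint_apply dual_left_def)

lemma product_bidual_apply:
  "cblinfun_apply (product_bidual M) f = cblinfun_apply M (cblinfun_apply (adjoint_map product_map) f)"
  by (simp add: product_bidual_def biadjoint_apply)

lemma tensor_bidual_commute_iff:
  "tensor_bidual_left a M = tensor_bidual_right M a \<longleftrightarrow>
    (\<forall>\<phi>. cblinfun_apply M (cblinfun_apply (adjoint_map (tensor_left a)) \<phi>) =
         cblinfun_apply M (cblinfun_apply (adjoint_map (tensor_right a)) \<phi>))"
  unfolding tensor_bidual_left_def tensor_bidual_right_def
  by (metis biadjoint_apply cblinfun_eqI)


section \<open>Virtual diagonals from approximate ones\<close>

text \<open>\<open>T\<close> is the action of \<open>n\<close> on the dual that underlies the Arens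
  products. It respects \<open>dual_left\<close> for any \<open>n\<close>; centrality gives the
  other side.\<close>

lemma central_operator:
  fixes n :: "'a::{complex_normed_algebra, banach} bidual"
  assumes central: "\<And>a f. cblinfun_apply n (dual_right f a) = cblinfun_apply n (dual_left a f)"
  obtains T where "\<And>f a. cblinfun_apply (cblinfun_apply T f) a = cblinfun_apply n (dual_left a f)"
    and "\<And>f a. cblinfun_apply T (dual_left a f) = dual_left a (cblinfun_apply T f)"
    and "\<And>f a. cblinfun_apply T (dual_right f a) = dual_right (cblinfun_apply T f) a"
proof -
  have bound: "norm (cblinfun_apply n (dual_left a f)) \<le> norm n * norm f * norm a" for a f
    using norm_cblinfun[of n "dual_left a f"]
      mult_left_mono[OF norm_dual_left_le[of a f], of "norm n"] by (simp add: mult.assoc)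
  have "\<exists>g. \<forall>a. cblinfun_apply g a = cblinfun_apply n (dual_left a f)" for f
    by (rule cblinfun_exists[of "\<lambda>a. cblinfun_apply n (dual_left a f)" "norm n * norm f"])
       (auto simp: dual_left_simps cblinfun_apply_add cblinfun_apply_scaleC bound)
  then obtain t where t: "\<And>f a. cblinfun_apply (t f) a = cblinfun_apply n (dual_left a f)"
    by metis
  have "\<exists>T. \<forall>f. cblinfun_apply T f = t f"
  proof (rule cblinfun_exists[of t "norm n"])
    show "norm (t f) \<le> norm n * norm f" for f
      by (rule norm_cblinfun_bound) (auto simp: t bound)
  qed (auto intro!: cblinfun_eqI simp: t dual_left_simps cblinfun_apply_add cblinfun_apply_scaleC
      cblinfun_apply_add_left cblinfun_apply_scaleC_left)
  then obtain T where T: "\<And>f. cblinfun_apply T f = t f" by blast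
  have left: "dual_left a (dual_left b f) = dual_left (a * b) f" for a b and f :: "'a dual"
    by (rule cblinfun_eqI) (simp add: dual_left_apply mult.assoc)
  have right: "dual_right (dual_right f b) a = dual_right f (b * a)" for a b and f :: "'a dual"
    by (rule cblinfun_eqI) (simp add: dual_right_apply mult.assoc)
  show ?thesis
  proof (rule that[of T])
    show "cblinfun_apply T (dual_left a f) = dual_left a (cblinfun_apply T f)" for f a
      by (rule cblinfun_eqI) (simp add: T t left dual_left_apply)
    \<comment> \<open>Centrality turns every \<open>dual_left\<close> under \<open>n\<close> into a
      \<open>dual_right\<close>; both sides then become \<open>n\<close> at the same right translate
      of \<open>f\<close>.\<close>
    show "cblinfun_apply T (dual_right f a) = dual_right (cblinfun_apply T f) a" for f a
      by (rule cblinfun_eqI) (simp add: T t dual_right_apply central[symmetric] right)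
  qed (simp add: T t)
qed

text \<open>Within distance 1 of the identity, the action of the product of \<open>m\<close> on the
  dual is invertible and can be divided out; so one term of an unbounded net is enough.\<close>

lemma amenable_if_near_diagonal:
  fixes m :: "('a::{complex_normed_algebra, banach}, 'a) proj_tensor bidual"
  assumes e: "\<And>a :: 'a. e * a = a" "\<And>a :: 'a. a * e = a"
    and comm: "\<And>a. tensor_bidual_left a m = tensor_bidual_right m a"
    and near: "norm (product_bidual m - canonical_embedding e) < 1"
  shows "amenable TYPE('a)"
proof -
  let ?n = "product_bidual m" and ?p = "cblinfun_apply (adjoint_map product_map)"
  have comm': "cblinfun_apply m (cblinfun_apply (adjoint_map (tensor_left a)) \<phi>) =
      cblinfun_apply m (cblinfun_apply (adjoint_map (tensor_right a)) \<phi>)" for a \<phi>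
    using comm[of a] unfolding tensor_bidual_commute_iff by blast
  have central: "cblinfun_apply ?n (dual_right f a) = cblinfun_apply ?n (dual_left a f)" for a f
    by (simp add: product_bidual_apply product_map_dual_left product_map_dual_right comm')
  obtain T where T: "\<And>f a. cblinfun_apply (cblinfun_apply T f) a = cblinfun_apply ?n (dual_left a f)"
    and T_left: "\<And>f a. cblinfun_apply T (dual_left a f) = dual_left a (cblinfun_apply T f)"
    and T_right: "\<And>f a. cblinfun_apply T (dual_right f a) = dual_right (cblinfun_apply T f) a"
    using central_operator[OF central] by blast
  let ?c = "norm (?n - canonical_embedding e)"
  have "norm (cblinfun_apply T f - f) \<le> ?c * norm f" for f
  proof (rule norm_cblinfun_bound)
    fix a
    \<comment> \<open>Since \<open>f a = f (e * a)\<close>, the subtracted value is that of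
      \<open>canonical_embedding e\<close> at \<open>dual_left a f\<close>.\<close>
    have "cblinfun_apply (cblinfun_apply T f - f) a =
        cblinfun_apply (?n - canonical_embedding e) (dual_left a f)"
      by (simp add: cblinfun_apply_diff_left T canonical_embedding_apply dual_left_apply e)
    also have "norm \<dots> \<le> ?c * norm (dual_left a f)"
      by (rule norm_cblinfun)
    also have "\<dots> \<le> ?c * (norm f * norm a)"
      by (intro mult_left_mono norm_dual_left_le) auto
    finally show "norm (cblinfun_apply (cblinfun_apply T f - f) a) \<le> ?c * norm f * norm a"
      by (simp add: mult.assoc)
  qed simp
  then obtain R where TR: "\<And>f. cblinfun_apply T (cblinfun_apply R f) = f"
    and RT: "\<And>f. cblinfun_apply R (cblinfun_apply T f) = f"
    using near_identity_inverse[OF norm_ge_zero near] by metis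
  \<comment> \<open>Write \<open>f\<close> as \<open>T (R f)\<close>, move the action inside
    \<open>T\<close>, and cancel \<open>R\<close> against \<open>T\<close>.\<close>
  have R_left: "cblinfun_apply R (dual_left a f) = dual_left a (cblinfun_apply R f)" for a f
    by (metis T_left TR RT)
  have R_right: "cblinfun_apply R (dual_right f a) = dual_right (cblinfun_apply R f) a" for a f
    by (metis T_right TR RT)
  obtain S :: "('a, 'a) proj_tensor dual \<Rightarrow>\<^sub>C\<^sub>L ('a, 'a) proj_tensor dual"
    where S: "\<And>\<phi> x. slice (cblinfun_apply S \<phi>) x = cblinfun_apply R (slice \<phi> x)"
    using slicewise_operator by blast
  have S_left: "cblinfun_apply S (cblinfun_apply (adjoint_map (tensor_left a)) \<phi>) =
      cblinfun_apply (adjoint_map (tensor_left a)) (cblinfun_apply S \<phi>)" for a \<phi>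
    by (rule proj_tensor_dual_eqI) (simp add: S slice_tensor_left)
  have S_right: "cblinfun_apply S (cblinfun_apply (adjoint_map (tensor_right a)) \<phi>) =
      cblinfun_apply (adjoint_map (tensor_right a)) (cblinfun_apply S \<phi>)" for a \<phi>
    by (rule proj_tensor_dual_eqI) (simp add: S slice_tensor_right R_left)
  \<comment> \<open>The slice of \<open>?p f\<close> at \<open>x\<close> is
    \<open>dual_right f x\<close>, so this is where \<open>R\<close> has to respect the right
    action.\<close>
  have S_product: "cblinfun_apply S (?p f) = ?p (cblinfun_apply R f)" for f
    by (rule proj_tensor_dual_eqI) (simp add: S slice_product_map R_right)
  define M where "M = cblinfun_apply (adjoint_map S) m"
  have M_product: "cblinfun_apply M (?p f) = cblinfun_apply f e" for f
  proof -
    \<comment> \<open>Inserting the trivial action of \<open>e\<close> exhibits the value as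
      \<open>T (R f)\<close> evaluated at \<open>e\<close>.\<close>
    have "cblinfun_apply M (?p f) = cblinfun_apply ?n (dual_left e (cblinfun_apply R f))"
      by (simp add: M_def adjoint_map_apply S_product product_bidual_apply dual_left_unit[OF e(2)])
    also have "\<dots> = cblinfun_apply f e"
      by (simp only: T[symmetric] TR)
    finally show ?thesis .
  qed
  have "tensor_bidual_left a M = tensor_bidual_right M a" for a
    unfolding tensor_bidual_commute_iff
    by (simp add: M_def adjoint_map_apply S_left S_right comm')
  moreover have "bidual_right (product_bidual M) a = canonical_embedding a" for a
    by (rule cblinfun_eqI)
       (simp add: bidual_right_apply product_bidual_apply M_product dual_left_apply e
         canonical_embedding_apply)
  ultimately show ?thesis unfolding amenable_def by blast
qed

theorem theorem2p1:
  assumes "\<exists>e :: 'a :: {complex_normed_algebra, banach}. \<forall>a. e * a = a \<and> a * e = a"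
    and "johnson_pseudo_contractible TYPE('a) TYPE('i)"
  shows "amenable TYPE('a)"
proof -
  obtain e :: 'a where e: "\<And>a. e * a = a" "\<And>a. a * e = a"
    using assms(1) by blast
  obtain I :: "'i set" and le and m :: "'i \<Rightarrow> ('a, 'a) proj_tensor bidual"
    where I: "directed_set I le"
      and comm: "\<And>a i. i \<in> I \<Longrightarrow> tensor_bidual_left a (m i) = tensor_bidual_right (m i) a"
      and lim: "\<And>a. net_tendsto I le
        (\<lambda>i. bidual_right (product_bidual (m i)) a - canonical_embedding a) 0"
    using assms(2) unfolding johnson_pseudo_contractible_def by blast
  have unit: "bidual_right n e = n" for n :: "'a bidual"
    by (rule cblinfun_eqI) (simp add: bidual_right_apply dual_left_unit[OF e(2)])
  \<comment> \<open>Convergence is used at \<open>e\<close> with tolerance 1; by reflexivity of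
    \<open>le\<close> the tail beginning at \<open>i\<close> contains \<open>i\<close>
    itself.\<close>
  obtain i where i: "i \<in> I" "norm (bidual_right (product_bidual (m i)) e - canonical_embedding e) < 1"
    using lim[of e] I unfolding net_tendsto_def directed_set_def
    by (metis diff_zero zero_less_one)
  show ?thesis
    by (rule amenable_if_near_diagonal[of e "m i"]) (use e comm i in \<open>auto simp: unit\<close>)
qed

end
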